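(* For a functionally Hausdorff space $X$ the following conditions are equivalent: (1) $X$ is metrizable. (2) $\mathsf{Law}(X)$ is metrizable. (3) $X$ is a $k^*$-metrizable $k$-space and $\mathsf{Law}(X)$ contains no $\mathrm{Fin}^\omega$-fan. (4) $X$ is a Tychonoff sequential $\aleph$-space and $\mathsf{Law}(X)$ contains no strong $\mathrm{Fin}^\omega$-fan. (5) $X$ is $k^*$-metrizable and $\mathsf{Law}(X)$ is a $k$-space.
   Context: $\mathsf{Law}(X)$ is the free Lawson semilattice over $X$; it can be identified with the hyperspace of all non-empty finite subsets of $X$ endowed with the Vietoris topology (and the semilattice operation of union). A base of the Vietoris topology consists of the sets $\langle U_1,\dots,U_n\rangle=\{F: F\subset\bigcup_{i=1}^nU_i \text{ and } F\cap U_i\neq\emptyset \text{ for all } i\le n\}$, where $U_1,\dots,U_n$ are open in $X$. A space $X$ is functionally Hausdorff if for any distinct $x,y\in X$ there is a continuous $f:X\to[0,1]$ with $f(x)=0$, $f(y)=1$. "Regular" includes $T_1$. A family $\mathcal N$ of subsets of $Y$ is a $k$-network if for each open $U\subset Y$ and compact $K\subset U$ there is a finite $\mathcal F\subset\mathcal N$ with $K\subset\bigcup\mathcal F\subset U$. A family of subsets of $Y$ is compact-finite if each compact subset of $Y$ meets only finitely many members, and locally finite if each point has a neighborhood meeting only finitely many members. A regular space is an $\aleph$-space if it has a $k$-network that is a countable union of locally finite families, and $k^*$-metrizable if it has a $k$-network that is a countable union of compact-finite families. $Y$ is a $k$-space if $A\subset Y$ is closed whenever $A\cap K$ is closed in $K$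 for every compact $K\subset Y$. $Y$ is sequential if for each non-closed $A\subset Y$ some sequence of points of $A$ converges to a point of $Y\setminus A$. An indexed family $(F_n)_{n\in\omega}$ of subsets of $Y$ is locally finite if each point of $Y$ has a neighborhood meeting $F_n$ for only finitely many $n$; it is compact-finite if each compact subset of $Y$ meets $F_n$ for only finitely many $n$. A set $U\subset Y$ is $\mathbb R$-open if for each $y\in U$ there is a continuous $f:Y\to[0,1]$ with $f(y)=1$ and $f(Y\setminus U)\subset\{0\}$. A $\mathrm{Fin}^\omega$-fan in $Y$ is a family $(F_n)_{n\in\omega}$ of finite subsets of $Y$ that is compact-finite but not locally finite; it is strong if each $F_n$ has an $\mathbb R$-open neighborhood $U_n\supset F_n$ such that $(U_n)_{n\in\omega}$ is compact-finite. *)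

theory Defs
  imports "HOL-Analysis.Analysis"
begin

definition functionally_Hausdorff_space :: "'a topology \<Rightarrow> bool" where
  "functionally_Hausdorff_space X \<longleftrightarrow>
     (\<forall>x\<in>topspace X. \<forall>y\<in>topspace X. x \<noteq> y \<longrightarrow>
        (\<exists>f::'a \<Rightarrow> real. continuous_map X (top_of_set {0..1}) f \<and> f x = 0 \<and> f y = 1))"

definition Tychonoff_space :: "'a topology \<Rightarrow> bool" where
  "Tychonoff_space X \<longleftrightarrow> t1_space X \<and> completely_regular_space X"

definition sequential_space :: "'a topology \<Rightarrow> bool" where
  "sequential_space X \<longleftrightarrow>
     (\<forall>A. A \<subseteq> topspace X \<and> \<not> closedin X A \<longrightarrow>
        (\<exists>s l. range s \<subseteq> A \<and> l \<in> topspace X - A \<and> limitin X s l sequentially))"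

definition k_network :: "'a topology \<Rightarrow> 'a set set \<Rightarrow> bool" where
  "k_network X \<N> \<longleftrightarrow> \<Union>\<N> \<subseteq> topspace X \<and>
     (\<forall>U K. openin X U \<and> compactin X K \<and> K \<subseteq> U \<longrightarrow>
        (\<exists>\<F>. finite \<F> \<and> \<F> \<subseteq> \<N> \<and> K \<subseteq> \<Union>\<F> \<and> \<Union>\<F> \<subseteq> U))"

definition compact_finite_in :: "'a topology \<Rightarrow> 'a set set \<Rightarrow> bool" where
  "compact_finite_in X \<A> \<longleftrightarrow> \<Union>\<A> \<subseteq> topspace X \<and>
     (\<forall>K. compactin X K \<longrightarrow> finite {A \<in> \<A>. A \<inter> K \<noteq> {}})"

text \<open>In the next two definitions regularity includes the separation axiom \<open>T\<^sub>1\<close>, which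
  \<^const>\<open>regular_space\<close> alone does not.\<close>

definition aleph_space :: "'a topology \<Rightarrow> bool" where
  "aleph_space X \<longleftrightarrow> t1_space X \<and> regular_space X \<and>
     (\<exists>\<N> :: nat \<Rightarrow> 'a set set. (\<forall>n. locally_finite_in X (\<N> n)) \<and> k_network X (\<Union>n. \<N> n))"

definition k_star_metrizable_space :: "'a topology \<Rightarrow> bool" where
  "k_star_metrizable_space X \<longleftrightarrow> t1_space X \<and> regular_space X \<and>
     (\<exists>\<N> :: nat \<Rightarrow> 'a set set. (\<forall>n. compact_finite_in X (\<N> n)) \<and> k_network X (\<Union>n. \<N> n))"

text \<open>For sequences of sets one counts indices, not members: a sequence with a nonempty set
  repeated infinitely often is neither locally finite nor compact-finite.\<close>

definition locally_finite_seq :: "'a topology \<Rightarrow> (nat \<Rightarrow> 'a set) \<Rightarrow> bool" where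
  "locally_finite_seq Y F \<longleftrightarrow>
     (\<forall>y\<in>topspace Y. \<exists>V. openin Y V \<and> y \<in> V \<and> finite {n. F n \<inter> V \<noteq> {}})"

definition compact_finite_seq :: "'a topology \<Rightarrow> (nat \<Rightarrow> 'a set) \<Rightarrow> bool" where
  "compact_finite_seq Y F \<longleftrightarrow> (\<forall>K. compactin Y K \<longrightarrow> finite {n. F n \<inter> K \<noteq> {}})"

definition R_open_in :: "'a topology \<Rightarrow> 'a set \<Rightarrow> bool" where
  "R_open_in Y U \<longleftrightarrow> U \<subseteq> topspace Y \<and>
     (\<forall>y\<in>U. \<exists>f::'a \<Rightarrow> real. continuous_map Y (top_of_set {0..1}) f \<and>
        f y = 1 \<and> f ` (topspace Y - U) \<subseteq> {0})"

definition Fin_omega_fan :: "'a topology \<Rightarrow> (nat \<Rightarrow> 'a set) \<Rightarrow> bool" where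
  "Fin_omega_fan Y F \<longleftrightarrow>
     (\<forall>n. finite (F n) \<and> F n \<subseteq> topspace Y) \<and>
     compact_finite_seq Y F \<and> \<not> locally_finite_seq Y F"

definition strong_Fin_omega_fan :: "'a topology \<Rightarrow> (nat \<Rightarrow> 'a set) \<Rightarrow> bool" where
  "strong_Fin_omega_fan Y F \<longleftrightarrow> Fin_omega_fan Y F \<and>
     (\<exists>U. (\<forall>n. R_open_in Y (U n) \<and> F n \<subseteq> U n) \<and> compact_finite_seq Y U)"

text \<open>\<open>vietoris_basic {U\<^sub>1, \<dots>, U\<^sub>n}\<close> is the basic Vietoris set \<open>\<langle>U\<^sub>1, \<dots>, U\<^sub>n\<rangle>\<close>, restricted to
  nonempty finite sets.\<close>

definition vietoris_basic :: "'a set set \<Rightarrow> 'a set set" where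
  "vietoris_basic \<U> = {F. finite F \<and> F \<noteq> {} \<and> F \<subseteq> \<Union>\<U> \<and> (\<forall>U\<in>\<U>. F \<inter> U \<noteq> {})}"

text \<open>The free Lawson semilattice over \<open>X\<close>, as a topological space: the hyperspace of nonempty
  finite subsets of \<open>X\<close> with the Vietoris topology. The semilattice operation is \<open>\<union>\<close>.\<close>

definition Law :: "'a topology \<Rightarrow> 'a set topology" where
  "Law X = topology (arbitrary union_of
     (\<lambda>W. \<exists>\<U>. finite \<U> \<and> \<U> \<noteq> {} \<and> (\<forall>U\<in>\<U>. openin X U) \<and> W = vietoris_basic \<U>))"

lemma vietoris_basic_Int:
  "vietoris_basic \<U> \<inter> vietoris_basic \<V> =
     vietoris_basic ((\<lambda>U. U \<inter> \<Union>\<V>) ` \<U> \<union> (\<lambda>V. V \<inter> \<Union>\<U>) ` \<V>)"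
proof -
  have W: "\<Union>((\<lambda>U. U \<inter> \<Union>\<V>) ` \<U> \<union> (\<lambda>V. V \<inter> \<Union>\<U>) ` \<V>) = \<Union>\<U> \<inter> \<Union>\<V>"
    by blast
  have "(\<forall>W\<in>(\<lambda>U. U \<inter> \<Union>\<V>) ` \<U> \<union> (\<lambda>V. V \<inter> \<Union>\<U>) ` \<V>. F \<inter> W \<noteq> {}) \<longleftrightarrow>
      (\<forall>U\<in>\<U>. F \<inter> U \<noteq> {}) \<and> (\<forall>V\<in>\<V>. F \<inter> V \<noteq> {})"
    if F: "F \<subseteq> \<Union>\<U>" "F \<subseteq> \<Union>\<V>" for F
  proof -
    have "F \<inter> (U \<inter> \<Union>\<V>) = F \<inter> U" "F \<inter> (U \<inter> \<Union>\<U>) = F \<inter> U" for U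
      using F by blast+
    then show ?thesis
      by (simp only: ball_Un ball_simps)
  qed
  then show ?thesis
    unfolding vietoris_basic_def W by (intro set_eqI) (simp only: mem_Collect_eq Int_iff le_inf_iff, metis)
qed

lemma openin_Law:
  "openin (Law X) = arbitrary union_of
     (\<lambda>W. \<exists>\<U>. finite \<U> \<and> \<U> \<noteq> {} \<and> (\<forall>U\<in>\<U>. openin X U) \<and> W = vietoris_basic \<U>)"
  unfolding Law_def
proof (rule topology_inverse', rule istopology_base)
  fix S T
  assume "\<exists>\<U>. finite \<U> \<and> \<U> \<noteq> {} \<and> (\<forall>U\<in>\<U>. openin X U) \<and> S = vietoris_basic \<U>"
    and "\<exists>\<U>. finite \<U> \<and> \<U> \<noteq> {} \<and> (\<forall>U\<in>\<U>. openin X U) \<and> T = vietoris_basic \<U>"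
  then obtain \<U> \<V> where
    U: "finite \<U>" "\<U> \<noteq> {}" "\<forall>U\<in>\<U>. openin X U" "S = vietoris_basic \<U>" and
    V: "finite \<V>" "\<V> \<noteq> {}" "\<forall>U\<in>\<V>. openin X U" "T = vietoris_basic \<V>"
    by blast
  let ?W = "(\<lambda>U. U \<inter> \<Union>\<V>) ` \<U> \<union> (\<lambda>V. V \<inter> \<Union>\<U>) ` \<V>"
  have "finite ?W" "?W \<noteq> {}" "S \<inter> T = vietoris_basic ?W"
    using U V by (simp_all add: vietoris_basic_Int)
  moreover have "\<forall>W\<in>?W. openin X W"
    using U(3) V(3) by (metis (no_types, lifting) Un_iff imageE openin_Int openin_Union)
  ultimately show "\<exists>\<U>. finite \<U> \<and> \<U> \<noteq> {} \<and> (\<forall>U\<in>\<U>. openin X U) \<and> S \<inter> T = vietoris_basic \<U>"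
    by blast
qed

lemma topspace_Law: "topspace (Law X) = {F. finite F \<and> F \<noteq> {} \<and> F \<subseteq> topspace X}"
proof
  show "topspace (Law X) \<subseteq> {F. finite F \<and> F \<noteq> {} \<and> F \<subseteq> topspace X}"
  proof
    fix F assume "F \<in> topspace (Law X)"
    then obtain W where "openin (Law X) W" "F \<in> W"
      by (auto simp: topspace_def)
    then obtain \<U> where U: "\<forall>U\<in>\<U>. openin X U" and F: "F \<in> vietoris_basic \<U>"
      unfolding openin_Law union_of_def by blast
    from U have "\<Union>\<U> \<subseteq> topspace X"
      by (simp add: Sup_le_iff openin_subset)
    with F show "F \<in> {F. finite F \<and> F \<noteq> {} \<and> F \<subseteq> topspace X}"
      unfolding vietoris_basic_def by blast
  qed
next
  have "openin (Law X) (vietoris_basic {topspace X})"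
    unfolding openin_Law by (rule arbitrary_union_of_inc) (intro exI[of _ "{topspace X}"], simp)
  moreover have "{F. finite F \<and> F \<noteq> {} \<and> F \<subseteq> topspace X} \<subseteq> vietoris_basic {topspace X}"
    by (auto simp: vietoris_basic_def)
  ultimately show "{F. finite F \<and> F \<noteq> {} \<and> F \<subseteq> topspace X} \<subseteq> topspace (Law X)"
    using openin_subset by blast
qed

end

theory Submission
  imports Defs
begin

text \<open>The hard implications all come from one construction. If \<open>s\<close> is an injective sequence converging
  to \<open>x\<close> and \<open>E n\<close> is a compact-finite sequence of countable sets accumulating at \<open>x\<close>, then the
  sets \<open>{a, s n, \<dots>, s (n + i)}\<close>, where \<open>a\<close> is the \<open>i\<close>-th point of \<open>E n\<close>, accumulate at \<open>{x}\<close> in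
  \<^term>\<open>Law X\<close> but form a compact-finite family, that is, a fan. Hence without fans every
  compact-finite sequence of countable sets of a sequential space is locally finite. Applied to the members
  of a compact-finite \<open>k\<close>-network this makes the network \<open>\<sigma>\<close>-locally finite; applied to the
  differences \<open>V - P n\<close>, where \<open>P n\<close> is the union of the members of level \<open>n\<close> inside \<open>U\<close> and
  \<open>x \<in> V \<subseteq> cl V \<subseteq> U\<close>, it puts \<open>x\<close> in the interior of some \<open>P n\<close>. Such a network yields normality, locally
  finite open expansions and finally a \<open>\<sigma>\<close>-locally finite base, so \<open>X\<close> is metrizable. Conversely, a
  metrizable space has a \<open>\<sigma>\<close>-locally finite base by A.H. Stone's argument, its hyperspace is metrized by
  the Hausdorff distance, and \<open>T\<^sub>1\<close> \<open>k\<close>-spaces contain no fans of finite sets.\<close>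

section \<open>Metrization by equicontinuous families; locally finite bases\<close>

text \<open>The metric is the supremum of |f x - f y| over the family. Equicontinuity puts an open
  set inside every ball, and the separation hypothesis puts a ball inside every open set; with T1
  the latter also makes \<open>d\<close> vanish only on the diagonal.\<close>

lemma metrizable_space_from_functions:
  fixes X :: "'a topology" and F :: "('a \<Rightarrow> real) set"
  assumes t1: "t1_space X"
    and bounded: "\<And>f x. f \<in> F \<Longrightarrow> x \<in> topspace X \<Longrightarrow> f x \<in> {0..1}"
    and equicontinuous: "\<And>x e. x \<in> topspace X \<Longrightarrow> e > 0 \<Longrightarrow>
      \<exists>V. openin X V \<and> x \<in> V \<and> (\<forall>y\<in>V. \<forall>f\<in>F. \<bar>f x - f y\<bar> \<le> e)"
    and separating: "\<And>x U. openin X U \<Longrightarrow> x \<in> U \<Longrightarrow>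
      \<exists>e>0. \<forall>y\<in>topspace X. (\<forall>f\<in>F. \<bar>f x - f y\<bar> < e) \<longrightarrow> y \<in> U"
  shows "metrizable_space X"
proof -
  define M where "M = topspace X"
  \<comment> \<open>The zero function keeps the supremum over a nonempty set when \<open>F\<close>
    is empty, and contributes only the value 0.\<close>
  define G where "G = insert (\<lambda>_. 0) F"
  \<comment> \<open>The value 0 off \<open>M\<close> gives nonnegativity and symmetry for all points
    of the type, as \<open>Metric_space\<close> demands.\<close>
  define d where "d x y = (if x \<in> M \<and> y \<in> M then SUP f\<in>G. \<bar>f x - f y\<bar> else 0)" for x y
  have G01: "f x \<in> {0..1}" if "f \<in> G" "x \<in> M" for f x
    using bounded that by (auto simp: G_def M_def)
  have bdd: "bdd_above ((\<lambda>f. \<bar>f x - f y\<bar>) ` G)" if "x \<in> M" "y \<in> M" for x y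
  proof (intro bdd_aboveI2[where M=1])
    fix f assume "f \<in> G"
    then show "\<bar>f x - f y\<bar> \<le> 1" using G01[of f x] G01[of f y] that by auto
  qed
  have d_le: "d x y \<le> e \<longleftrightarrow> 0 \<le> e \<and> (\<forall>f\<in>F. \<bar>f x - f y\<bar> \<le> e)"
    if "x \<in> M" "y \<in> M" for x y e
  proof -
    have "d x y \<le> e \<longleftrightarrow> (\<forall>f\<in>G. \<bar>f x - f y\<bar> \<le> e)"
      using cSUP_le_iff[OF _ bdd[OF that], of e] that by (auto simp: d_def G_def)
    then show ?thesis by (auto simp: G_def)
  qed
  have d_nonneg: "0 \<le> d x y" for x y
    using d_le[of x y "d x y"] by (cases "x \<in> M \<and> y \<in> M") (auto simp: d_def)
  have le_d: "\<bar>f x - f y\<bar> \<le> d x y" if "f \<in> F" "x \<in> M" "y \<in> M" for f x y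
    using d_le[of x y "d x y"] that by auto
  have small: "\<exists>e>0. \<forall>y\<in>M. d x y < e \<longrightarrow> y \<in> U" if U: "openin X U" "x \<in> U" for x U
  proof -
    have "x \<in> M" using U openin_subset M_def by blast
    then show ?thesis
      using separating[OF U] le_d by (metis M_def le_less_trans)
  qed
  interpret Metric_space M d
  proof
    show "0 \<le> d x y" for x y by (rule d_nonneg)
    show "d x y = d y x" for x y
      by (simp add: d_def abs_minus_commute)
    show "d x y = 0 \<longleftrightarrow> x = y" if "x \<in> M" "y \<in> M" for x y
    proof
      assume "d x y = 0"
      show "x = y"
      proof (rule ccontr)
        assume "x \<noteq> y"
        then obtain U where "openin X U" "x \<in> U" "y \<notin> U"
          using t1 \<open>x \<in> M\<close> \<open>y \<in> M\<close> unfolding t1_space_def M_def by blast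
        with small \<open>d x y = 0\<close> \<open>y \<in> M\<close> show False by metis
      qed
    next
      assume "x = y"
      then have "d x y \<le> 0" using that by (subst d_le) auto
      then show "d x y = 0" using d_nonneg[of x y] by simp
    qed
    show "d x z \<le> d x y + d y z" if xyz: "x \<in> M" "y \<in> M" "z \<in> M" for x y z
    proof (subst d_le[OF xyz(1,3)], intro conjI ballI)
      show "0 \<le> d x y + d y z" using d_nonneg[of x y] d_nonneg[of y z] by simp
      show "\<bar>f x - f z\<bar> \<le> d x y + d y z" if "f \<in> F" for f
        using le_d[OF that, of x y] le_d[OF that, of y z] xyz by simp
    qed
  qed
  have "openin mtopology U \<longleftrightarrow> openin X U" for U
  proof
    assume U: "openin X U"
    show "openin mtopology U"
      unfolding openin_mtopology
    proof (intro conjI allI impI)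
      show "U \<subseteq> M" using openin_subset[OF U] by (simp add: M_def)
      fix x assume "x \<in> U"
      from small[OF U this] show "\<exists>r>0. mball x r \<subseteq> U" by (auto simp: in_mball)
    qed
  next
    assume U: "openin mtopology U"
    show "openin X U"
    proof (subst openin_subopen, intro ballI)
      fix x assume "x \<in> U"
      then obtain r where r: "r > 0" "mball x r \<subseteq> U" and x: "x \<in> M"
        using U unfolding openin_mtopology by blast
      \<comment> \<open>Half of \<open>r\<close>, because bounds on the individual functions give
        only a non-strict bound on their supremum.\<close>
      obtain V where V: "openin X V" "x \<in> V" "\<forall>y\<in>V. \<forall>f\<in>F. \<bar>f x - f y\<bar> \<le> r / 2"
        using equicontinuous[of x "r / 2"] r x by (auto simp: M_def)
      have "V \<subseteq> U"
      proof
        fix y assume "y \<in> V"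
        then have "y \<in> M" using openin_subset[OF V(1)] by (auto simp: M_def)
        then have "d x y \<le> r / 2" using V(3) \<open>y \<in> V\<close> r x by (subst d_le) auto
        then show "y \<in> U" using r x \<open>y \<in> M\<close> by (auto simp: subset_iff in_mball)
      qed
      then show "\<exists>T. openin X T \<and> x \<in> T \<and> T \<subseteq> U" using V by blast
    qed
  qed
  then have "mtopology = X" by (simp add: topology_eq)
  then show ?thesis using metrizable_space_mtopology by simp
qed

text \<open>A.H. Stone's theorem. For a well-ordered cover \<open>C\<close> by balls, the sets \<open>E n p\<close> of points
  that lie \<open>\<epsilon> n\<close>-deep in \<open>C p\<close> but in no earlier \<open>C q\<close> are \<open>\<epsilon> n\<close>-separated for fixed \<open>n\<close>.\<close>

lemma metrizable_imp_sigma_locally_finite_base: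
  assumes "metrizable_space X"
  obtains B :: "nat \<Rightarrow> 'a set set"
  where "\<And>n. locally_finite_in X (B n)" "\<And>n U. U \<in> B n \<Longrightarrow> openin X U"
    "\<And>U x. openin X U \<Longrightarrow> x \<in> U \<Longrightarrow> \<exists>n. \<exists>V\<in>B n. x \<in> V \<and> V \<subseteq> U"
proof -
  obtain M d where "Metric_space M d" and X: "X = Metric_space.mtopology M d"
    using assms unfolding metrizable_space_def by blast
  interpret Metric_space M d by fact
  obtain r :: "'a rel" where r: "Well_order r \<and> Field r = UNIV"
    using well_ordering ..
  define lt where "lt p q \<longleftrightarrow> (p, q) \<in> r - Id" for p q
  have wf: "wf (r - Id)" using r unfolding well_order_on_def by blast
  have total: "lt p q \<or> lt q p" if "p \<noteq> q" for p q
    using r that unfolding well_order_on_def linear_order_on_def total_on_def lt_def by auto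
  define eps :: "nat \<Rightarrow> real" where "eps n = inverse (real (Suc n))" for n
  have eps_pos: "eps n > 0" for n by (simp add: eps_def)
  have eps_small: "\<exists>n. eps n < e" if "e > 0" for e
    using reals_Archimedean[OF that] by (auto simp: eps_def)
  define C where "C k p = mball p (eps k)" for k p
  define E where "E k n p = {x \<in> M. mball x (eps n) \<subseteq> C k p \<and> (\<forall>q. lt q p \<longrightarrow> x \<notin> C k q)}"
    for k n p
  define D where "D k n p = (\<Union>x\<in>E k n p. mball x (eps n / 3))" for k n p
  define B where "B i = (case prod_decode i of (k, n) \<Rightarrow> range (D k n))" for i
  \<comment> \<open>If \<open>x\<close> and \<open>y\<close> were closer than \<open>eps n\<close>,
    then \<open>y\<close> would lie in the \<open>eps n\<close>-ball about \<open>x\<close>, hence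
    in the earlier set \<open>C k q\<close>, which \<open>E k n p\<close> excludes.\<close>
  have sep1: "eps n \<le> d x y" if "x \<in> E k n q" "y \<in> E k n p" "lt q p" for x y k n p q
  proof (rule ccontr)
    assume "\<not> ?thesis"
    then have "y \<in> mball x (eps n)" using that by (simp add: E_def)
    then show False using that by (auto simp: E_def)
  qed
  have sep: "p = q" if "x \<in> E k n p" "y \<in> E k n q" "d x y < eps n" for x y k n p q
    using sep1[of x k n p y q] sep1[of y k n q x p] total[of p q] that commute[of x y] by force
  show thesis
  proof (rule that[of B])
    fix i
    obtain k n where i: "prod_decode i = (k, n)" by fastforce
    have Bi: "B i = range (D k n)" by (simp add: B_def i)
    show op: "openin X U" if "U \<in> B i" for U
      using that by (auto simp: Bi D_def X)
    show "locally_finite_in X (B i)"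
      unfolding locally_finite_in_def
    proof (intro conjI ballI)
      show "\<Union>(B i) \<subseteq> topspace X" using op openin_subset by blast
      fix x assume "x \<in> topspace X"
      then have x: "x \<in> M" by (simp add: X)
      \<comment> \<open>Two members meeting this ball come from points of \<open>E\<close> at
        distance below (1/3 + 1/6 + 1/6 + 1/3) \<open>eps n\<close>, so \<open>sep\<close>
        identifies them: at most one member meets it.\<close>
      let ?V = "mball x (eps n / 6)"
      have "U = U'" if U: "U \<in> B i" "U \<inter> ?V \<noteq> {}" and U': "U' \<in> B i" "U' \<inter> ?V \<noteq> {}" for U U'
      proof -
        obtain p q where p: "U = D k n p" and q: "U' = D k n q" using U(1) U'(1) by (auto simp: Bi)
        obtain a u where a: "a \<in> E k n p" "u \<in> mball a (eps n / 3)" "u \<in> ?V"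
          using U(2) unfolding p D_def by blast
        obtain b v where b: "b \<in> E k n q" "v \<in> mball b (eps n / 3)" "v \<in> ?V"
          using U'(2) unfolding q D_def by blast
        have "a \<in> M" "u \<in> M" "v \<in> M" "b \<in> M" using a b by (auto simp: in_mball)
        then have "d a b \<le> d a u + d u x + d x v + d v b"
          using x triangle[of a u b] triangle[of u x b] triangle[of x v b] by linarith
        also have "\<dots> < eps n"
          using a b commute[of u x] commute[of v b] by (auto simp: in_mball)
        finally show ?thesis using sep[OF a(1) b(1)] by (simp add: p q)
      qed
      then have *: "{U \<in> B i. U \<inter> ?V \<noteq> {}} \<subseteq> {U0}" if "U0 \<in> B i" "U0 \<inter> ?V \<noteq> {}" for U0
        using that by blast
      have "finite {U \<in> B i. U \<inter> ?V \<noteq> {}}"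
      proof (cases "{U \<in> B i. U \<inter> ?V \<noteq> {}} = {}")
        case False
        then obtain U0 where "U0 \<in> B i" "U0 \<inter> ?V \<noteq> {}" by auto
        from finite_subset[OF *[OF this]] show ?thesis by simp
      qed (simp only: finite.emptyI)
      then show "\<exists>V. openin X V \<and> x \<in> V \<and> finite {U \<in> B i. U \<inter> V \<noteq> {}}"
        using x eps_pos[of n] by (intro exI[of _ ?V]) (auto simp: X)
    qed
  next
    fix U x assume "openin X U" "x \<in> U"
    then obtain e where e: "e > 0" "mball x e \<subseteq> U" and x: "x \<in> M"
      unfolding X openin_mtopology by blast
    obtain k where k: "eps k < e / 2" using eps_small[of "e / 2"] e by auto
    have "x \<in> C k x" using x eps_pos by (simp add: C_def)
    then have "x \<in> {p. x \<in> C k p}" by simp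
    \<comment> \<open>\<open>p\<close> is least in the well-order among the centres whose
      \<open>eps k\<close>-ball contains \<open>x\<close>; \<open>x\<close> itself is such a
      centre.\<close>
    then obtain p where p: "x \<in> C k p" "\<And>q. lt q p \<Longrightarrow> x \<notin> C k q"
      using wfE_min[OF wf] unfolding lt_def by (metis mem_Collect_eq)
    have "openin mtopology (C k p)" by (simp add: C_def)
    then obtain e' where "e' > 0" "mball x e' \<subseteq> C k p"
      using p(1) unfolding openin_mtopology by blast
    moreover then obtain n where "eps n < e'" using eps_small by blast
    ultimately have "mball x (eps n) \<subseteq> C k p" using mball_subset_concentric[of "eps n" e' x] by force
    then have "x \<in> E k n p" using p x by (simp add: E_def)
    then have "x \<in> D k n p" using x eps_pos[of n] by (force simp: D_def)
    moreover have "D k n p \<subseteq> U"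
    proof -
      have "D k n p \<subseteq> C k p"
        using mball_subset_concentric[of "eps n / 3" "eps n"] eps_pos[of n] by (force simp: D_def E_def)
      also have "\<dots> \<subseteq> mball x e"
      proof
        fix y assume "y \<in> C k p"
        then show "y \<in> mball x e"
          using p(1) k triangle[of x p y] commute[of x p] by (auto simp: C_def in_mball)
      qed
      finally show ?thesis using e by blast
    qed
    moreover have "D k n p \<in> B (prod_encode (k, n))" by (simp add: B_def)
    ultimately show "\<exists>n. \<exists>V\<in>B n. x \<in> V \<and> V \<subseteq> U" by blast
  qed
qed

section \<open>Topology of the hyperspace\<close>

lemma openin_Law_vietoris_basic:
  assumes "finite \<U>" "\<U> \<noteq> {}" "\<And>U. U \<in> \<U> \<Longrightarrow> openin X U"
  shows "openin (Law X) (vietoris_basic \<U>)"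
  unfolding openin_Law by (rule arbitrary_union_of_inc) (use assms in blast)

lemma openin_Law_subset:
  assumes "openin X U"
  shows "openin (Law X) {A \<in> topspace (Law X). A \<subseteq> U}"
proof -
  have "{A \<in> topspace (Law X). A \<subseteq> U} = vietoris_basic {U}"
    using openin_subset[OF assms] by (auto simp: vietoris_basic_def topspace_Law)
  then show ?thesis using openin_Law_vietoris_basic[of "{U}"] assms by simp
qed

lemma openin_Law_meets:
  assumes "openin X U"
  shows "openin (Law X) {A \<in> topspace (Law X). A \<inter> U \<noteq> {}}"
proof -
  have "{A \<in> topspace (Law X). A \<inter> U \<noteq> {}} = vietoris_basic {U, topspace X}"
    using openin_subset[OF assms] by (auto simp: vietoris_basic_def topspace_Law)
  then show ?thesis using openin_Law_vietoris_basic[of "{U, topspace X}" X] assms by auto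
qed

lemma Law_basic_neighbourhood:
  assumes "openin (Law X) W" "A \<in> W"
  obtains \<U> where "finite \<U>" "\<U> \<noteq> {}" "\<forall>U\<in>\<U>. openin X U"
    "A \<in> vietoris_basic \<U>" "vietoris_basic \<U> \<subseteq> W"
proof -
  obtain \<W> where \<W>: "\<W> \<subseteq> Collect (\<lambda>W. \<exists>\<U>. finite \<U> \<and> \<U> \<noteq> {} \<and> (\<forall>U\<in>\<U>. openin X U) \<and>
      W = vietoris_basic \<U>)" "\<Union>\<W> = W"
    using assms(1) unfolding openin_Law union_of_def by blast
  then obtain B where B: "B \<in> \<W>" "A \<in> B" using assms(2) by blast
  then have "B \<subseteq> W" using \<W>(2) by blast
  moreover obtain \<U> where "finite \<U>" "\<U> \<noteq> {}" "\<forall>U\<in>\<U>. openin X U" "B = vietoris_basic \<U>"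
    using \<W>(1) B(1) by blast
  ultimately show thesis using that B(2) by blast
qed

text \<open>A singleton belongs to a basic Vietoris set only if its point lies in every generating
  open set, so their intersection serves as \<open>U\<close>.\<close>

lemma Law_singleton_neighbourhood:
  assumes "openin (Law X) W" "{x} \<in> W"
  obtains U where "openin X U" "x \<in> U" "\<And>A. A \<in> topspace (Law X) \<Longrightarrow> A \<subseteq> U \<Longrightarrow> A \<in> W"
proof -
  obtain \<U> where \<U>: "finite \<U>" "\<U> \<noteq> {}" "\<forall>U\<in>\<U>. openin X U"
    "{x} \<in> vietoris_basic \<U>" "vietoris_basic \<U> \<subseteq> W"
    by (rule Law_basic_neighbourhood[OF assms])
  show thesis
  proof (rule that[of "\<Inter>\<U>"])
    show "openin X (\<Inter>\<U>)" using \<U>(1-3) by (intro openin_Inter) auto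
    show "x \<in> \<Inter>\<U>" using \<U>(4) by (auto simp: vietoris_basic_def)
    fix A assume A: "A \<in> topspace (Law X)" "A \<subseteq> \<Inter>\<U>"
    then have "finite A" "A \<noteq> {}" by (simp_all add: topspace_Law)
    moreover have "A \<subseteq> \<Union>\<U>" using \<U>(2) A(2) by blast
    moreover have "A \<inter> U = A" if "U \<in> \<U>" for U using A(2) that by blast
    ultimately have "A \<in> vietoris_basic \<U>" by (simp add: vietoris_basic_def)
    then show "A \<in> W" using \<U>(5) by blast
  qed
qed

text \<open>Finite sets are closed, so \<open>A\<close> not inside \<open>B\<close> meets the open
  complement of \<open>B\<close>; otherwise some b in \<open>B\<close> is missing from
  \<open>A\<close>, and \<open>A\<close> lies in the open complement of b.\<close>

lemma t1_space_Law:
  assumes "t1_space X"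
  shows "t1_space (Law X)"
  unfolding t1_space_def
proof (intro ballI impI)
  fix A B assume A: "A \<in> topspace (Law X)" and B: "B \<in> topspace (Law X)" and "A \<noteq> B"
  then consider "\<not> A \<subseteq> B" | b where "b \<in> B" "b \<notin> A" by blast
  then show "\<exists>W. openin (Law X) W \<and> A \<in> W \<and> B \<notin> W"
  proof cases
    case 1
    have "openin X (topspace X - B)"
      using B assms by (simp add: topspace_Law t1_space_closedin_finite openin_diff)
    then show ?thesis
      by (intro exI conjI, rule openin_Law_meets) (use A 1 in \<open>auto simp: topspace_Law\<close>)
  next
    case 2
    have "openin X (topspace X - {b})"
      using assms 2 B by (auto simp: topspace_Law t1_space_closedin_singleton intro!: openin_diff)
    then show ?thesis
      by (intro exI conjI, rule openin_Law_subset) (use A 2 in \<open>auto simp: topspace_Law\<close>)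
  qed
qed

text \<open>Members of \<K> are finite, hence each is covered by a finite subfamily of a given open
  cover. The open sets \<open>N \<F>\<close> therefore cover \<K>, and finitely many of the families
  \<F> combine to a finite subcover.\<close>

lemma compactin_Union_Law:
  assumes "compactin (Law X) \<K>"
  shows "compactin X (\<Union>\<K>)"
  unfolding compactin_def
proof (intro conjI allI impI)
  have K: "\<And>A. A \<in> \<K> \<Longrightarrow> A \<in> topspace (Law X)"
    using compactin_subset_topspace[OF assms] by blast
  then show "\<Union>\<K> \<subseteq> topspace X" by (auto simp: topspace_Law)
  fix \<V> assume \<V>: "(\<forall>V\<in>\<V>. openin X V) \<and> \<Union>\<K> \<subseteq> \<Union>\<V>"
  define N where "N \<F> = {A \<in> topspace (Law X). A \<subseteq> \<Union>\<F>}" for \<F>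
  have "\<exists>\<F>. finite \<F> \<and> \<F> \<subseteq> \<V> \<and> A \<in> N \<F>" if "A \<in> \<K>" for A
  proof -
    have "finite A" "A \<subseteq> \<Union>\<V>" using that K \<V> by (auto simp: topspace_Law)
    then obtain \<F> where "finite \<F>" "\<F> \<subseteq> \<V>" "A \<subseteq> \<Union>\<F>"
      using finite_subset_Union by metis
    then show ?thesis using K that by (auto simp: N_def)
  qed
  then have cover: "\<K> \<subseteq> \<Union>(N ` {\<F>. finite \<F> \<and> \<F> \<subseteq> \<V>})" by blast
  have op: "openin (Law X) W" if "W \<in> N ` {\<F>. finite \<F> \<and> \<F> \<subseteq> \<V>}" for W
    using that \<V> unfolding N_def by (auto intro!: openin_Law_subset openin_Union)
  obtain \<G> where \<G>: "finite \<G>" "\<G> \<subseteq> N ` {\<F>. finite \<F> \<and> \<F> \<subseteq> \<V>}" "\<K> \<subseteq> \<Union>\<G>"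
    using compactinD[OF assms op cover] by auto
  obtain H where H: "H \<subseteq> {\<F>. finite \<F> \<and> \<F> \<subseteq> \<V>}" "finite H" "\<G> = N ` H"
    using finite_subset_image[OF \<G>(1,2)] by auto
  have "\<Union>\<K> \<subseteq> \<Union>(\<Union>H)" using \<G>(3) unfolding H(3) N_def by blast
  then show "\<exists>\<F>. finite \<F> \<and> \<F> \<subseteq> \<V> \<and> \<Union>\<K> \<subseteq> \<Union>\<F>"
    using H by (intro exI[of _ "\<Union>H"]) auto
qed

section \<open>The copy of X inside its hyperspace\<close>

lemma homeomorphic_space_Law_singletons:
  "X homeomorphic_space subtopology (Law X) ((\<lambda>x. {x}) ` topspace X)"
proof -
  let ?S = "(\<lambda>x. {x}) ` topspace X"
  have "continuous_map X (Law X) (\<lambda>x. {x})"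
    unfolding continuous_map_def
  proof (intro conjI allI impI)
    fix W assume W: "openin (Law X) W"
    show "openin X {x \<in> topspace X. {x} \<in> W}"
    proof (subst openin_subopen, intro ballI)
      fix x assume "x \<in> {x \<in> topspace X. {x} \<in> W}"
      then obtain U where U: "openin X U" "x \<in> U"
        "\<And>A. A \<in> topspace (Law X) \<Longrightarrow> A \<subseteq> U \<Longrightarrow> A \<in> W"
        using Law_singleton_neighbourhood[OF W, of x] by auto
      have "U \<subseteq> {x \<in> topspace X. {x} \<in> W}"
        using U(3) openin_subset[OF U(1)] by (auto simp: topspace_Law)
      then show "\<exists>T. openin X T \<and> x \<in> T \<and> T \<subseteq> {x \<in> topspace X. {x} \<in> W}" using U by blast
    qed
  qed (auto simp: topspace_Law)
  then have 1: "continuous_map X (subtopology (Law X) ?S) (\<lambda>x. {x})"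
    by (auto simp: continuous_map_in_subtopology)
  have 2: "continuous_map (subtopology (Law X) ?S) X the_elem"
    unfolding continuous_map_def
  proof (intro conjI allI impI)
    show "the_elem \<in> topspace (subtopology (Law X) ?S) \<rightarrow> topspace X" by auto
    fix U assume U: "openin X U"
    have "{A \<in> topspace (subtopology (Law X) ?S). the_elem A \<in> U} =
        {A \<in> topspace (Law X). A \<subseteq> U} \<inter> ?S"
      by (auto simp: topspace_Law)
    then show "openin (subtopology (Law X) ?S) {A \<in> topspace (subtopology (Law X) ?S). the_elem A \<in> U}"
      using openin_subtopology_Int[OF openin_Law_subset[OF U], of ?S] by simp
  qed
  show ?thesis
    unfolding homeomorphic_space_def homeomorphic_maps_def
    using 1 2 by (intro exI[of _ "\<lambda>x. {x}"] exI[of _ the_elem]) auto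
qed

text \<open>A set with two distinct points a, b is separated from the singletons by the open family
  of all sets meeting both of two disjoint neighbourhoods of a and b.\<close>

lemma closedin_Law_singletons:
  assumes "Hausdorff_space X"
  shows "closedin (Law X) ((\<lambda>x. {x}) ` topspace X)"
  unfolding closedin_def
proof
  let ?S = "(\<lambda>x. {x}) ` topspace X"
  show "?S \<subseteq> topspace (Law X)" by (auto simp: topspace_Law)
  show "openin (Law X) (topspace (Law X) - ?S)"
  proof (subst openin_subopen, intro ballI)
    fix A assume A: "A \<in> topspace (Law X) - ?S"
    then obtain a where a: "a \<in> A" "a \<in> topspace X" by (auto simp: topspace_Law)
    then have "A \<noteq> {a}" using A by blast
    then obtain b where b: "b \<in> A" "b \<noteq> a" "b \<in> topspace X" using a A by (auto simp: topspace_Law)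
    obtain U V where UV: "openin X U" "openin X V" "a \<in> U" "b \<in> V" "disjnt U V"
      using assms a b unfolding Hausdorff_space_def by metis
    let ?T = "{A \<in> topspace (Law X). A \<inter> U \<noteq> {}} \<inter> {A \<in> topspace (Law X). A \<inter> V \<noteq> {}}"
    have "openin (Law X) ?T" using UV openin_Law_meets by blast
    moreover have "A \<in> ?T" using A a b UV by auto
    moreover have "?T \<subseteq> topspace (Law X) - ?S" using UV(5) by (auto simp: disjnt_iff)
    ultimately show "\<exists>T. openin (Law X) T \<and> A \<in> T \<and> T \<subseteq> topspace (Law X) - ?S" by blast
  qed
qed

lemma k_space_Law_imp_k_space:
  assumes "Hausdorff_space X" "k_space (Law X)"
  shows "k_space X"
  using k_space_closed_subtopology[OF assms(2) closedin_Law_singletons[OF assms(1)]]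
    homeomorphic_k_space[OF homeomorphic_space_Law_singletons] by blast

text \<open>The separating functions are the truncated distances to points of \<open>X\<close>, so the metric obtained
  on \<^term>\<open>Law X\<close> is the Hausdorff metric.\<close>

lemma metrizable_space_Law:
  assumes "metrizable_space X"
  shows "metrizable_space (Law X)"
proof -
  obtain M d where "Metric_space M d" and X: "X = Metric_space.mtopology M d"
    using assms unfolding metrizable_space_def by blast
  interpret Metric_space M d by fact
  have topX: "topspace X = M" by (simp add: X)
  \<comment> \<open>This is the distance from \<open>p\<close> to the finite set \<open>A\<close>,
    truncated at 1 so that its values lie in [0,1].\<close>
  define f where "f p A = Min ((\<lambda>a. min 1 (d p a)) ` A)" for p A
  have attained: "\<exists>a\<in>A. f p A = min 1 (d p a)" if "A \<in> topspace (Law X)" for p A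
  proof -
    have "f p A \<in> (\<lambda>a. min 1 (d p a)) ` A"
      unfolding f_def using that by (intro Min_in) (auto simp: topspace_Law)
    then show ?thesis by blast
  qed
  have f_le: "f p A \<le> min 1 (d p a)" if "A \<in> topspace (Law X)" "a \<in> A" for p A a
    unfolding f_def using that by (intro Min_le imageI) (auto simp: topspace_Law)
  have close: "f p B \<le> f p A + e"
    if A: "A \<in> topspace (Law X)" and B: "B \<in> topspace (Law X)" and p: "p \<in> M"
      and AB: "\<forall>a\<in>A. \<exists>b\<in>B. d a b < e" for A B p e
  proof -
    obtain a where a: "a \<in> A" "f p A = min 1 (d p a)" using attained[OF A] by blast
    obtain b where b: "b \<in> B" "d a b < e" using a AB by blast
    have "a \<in> M" "b \<in> M" using a b A B by (auto simp: topspace_Law topX)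
    then have "d p b \<le> d p a + d a b" using triangle p by blast
    then show ?thesis using f_le[OF B b(1), of p] a(2) b(2) nonneg[of a b] by linarith
  qed
  show ?thesis
  proof (rule metrizable_space_from_functions[where F="f ` M"])
    show "t1_space (Law X)" using assms metrizable_imp_t1_space t1_space_Law by blast
    show "g A \<in> {0..1}" if g: "g \<in> f ` M" and A: "A \<in> topspace (Law X)" for g A
    proof -
      obtain p where "g = f p" using g by blast
      moreover obtain a where "f p A = min 1 (d p a)" using attained[OF A] by blast
      ultimately show ?thesis by simp
    qed
  next
    fix A and e :: real assume A: "A \<in> topspace (Law X)" and e: "e > 0"
    \<comment> \<open>A member \<open>B\<close> of this set has points within \<open>e\<close> of
      each point of \<open>A\<close>, and conversely; \<open>close\<close>, applied both ways,
      bounds the difference uniformly in \<open>p\<close>.\<close>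
    let ?V = "vietoris_basic ((\<lambda>a. mball a e) ` A)"
    have AM: "finite A" "A \<noteq> {}" "A \<subseteq> M" using A by (auto simp: topspace_Law topX)
    have op: "openin (Law X) ?V" using AM by (intro openin_Law_vietoris_basic) (auto simp: X)
    have "\<bar>f p A - f p B\<bar> \<le> e" if "B \<in> ?V" "p \<in> M" for p B
    proof -
      have B: "B \<in> topspace (Law X)" using openin_subset[OF op] that by blast
      have hit: "B \<inter> mball a e \<noteq> {}" if "a \<in> A" for a
        using \<open>B \<in> ?V\<close> that by (simp add: vietoris_basic_def)
      have cover: "B \<subseteq> (\<Union>a\<in>A. mball a e)"
        using \<open>B \<in> ?V\<close> by (simp add: vietoris_basic_def)
      have "\<exists>b\<in>B. d a b < e" if "a \<in> A" for a using hit[OF that] by auto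
      then have "f p B \<le> f p A + e" using close[OF A B \<open>p \<in> M\<close>] by simp
      moreover have "\<exists>a\<in>A. d b a < e" if "b \<in> B" for b
      proof -
        obtain a where "a \<in> A" "b \<in> mball a e" using cover \<open>b \<in> B\<close> by auto
        then show ?thesis by (auto simp: commute)
      qed
      then have "f p A \<le> f p B + e" using close[OF B A \<open>p \<in> M\<close>] by simp
      ultimately show ?thesis by simp
    qed
    moreover have "A \<in> ?V" using AM e by (auto simp: vietoris_basic_def in_mball)
    ultimately show "\<exists>V. openin (Law X) V \<and> A \<in> V \<and> (\<forall>B\<in>V. \<forall>g\<in>f ` M. \<bar>g A - g B\<bar> \<le> e)"
      using op by blast
  next
    fix W A assume W: "openin (Law X) W" "A \<in> W"
    then have A: "A \<in> topspace (Law X)" using openin_subset by blast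
    obtain \<U> where \<U>: "finite \<U>" "\<U> \<noteq> {}" "\<forall>U\<in>\<U>. openin X U"
      "A \<in> vietoris_basic \<U>" "vietoris_basic \<U> \<subseteq> W"
      by (rule Law_basic_neighbourhood[OF W])
    have AM: "finite A" "A \<noteq> {}" "A \<subseteq> M" using A by (auto simp: topspace_Law topX)
    \<comment> \<open>One radius serves all members of \<U> containing \<open>a\<close>. The cap 1
      matters later: below 1 the truncated and the true distance agree.\<close>
    have "\<exists>r. 0 < r \<and> r \<le> 1 \<and> (\<forall>U\<in>\<U>. a \<in> U \<longrightarrow> mball a r \<subseteq> U)" if "a \<in> A" for a
    proof -
      have "{U \<in> \<U>. a \<in> U} \<noteq> {}" using \<U>(4) that by (auto simp: vietoris_basic_def)
      then have "openin X (\<Inter>{U \<in> \<U>. a \<in> U})" using \<U>(1,3) by (intro openin_Inter) auto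
      then obtain r where "r > 0" "mball a r \<subseteq> \<Inter>{U \<in> \<U>. a \<in> U}"
        unfolding X openin_mtopology by blast
      then show ?thesis
        using mball_subset_concentric[of "min r 1" r a] by (intro exI[of _ "min r 1"]) auto
    qed
    then obtain r where r: "\<And>a. a \<in> A \<Longrightarrow> 0 < r a \<and> r a \<le> 1 \<and> (\<forall>U\<in>\<U>. a \<in> U \<longrightarrow> mball a (r a) \<subseteq> U)"
      by metis
    define e where "e = Min (r ` A)"
    have e: "e > 0" "\<And>a. a \<in> A \<Longrightarrow> e \<le> r a" using AM r by (auto simp: e_def)
    have e1: "e \<le> 1" using AM r e by (meson all_not_in_conv order_trans)
    have "B \<in> W" if B: "B \<in> topspace (Law X)" and close: "\<forall>g\<in>f ` M. \<bar>g A - g B\<bar> < e" for B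
    proof -
      \<comment> \<open>Testing with a point \<open>p\<close> of \<open>A'\<close> itself makes
        \<open>f p A'\<close> zero, so \<open>f p B'\<close> is below \<open>e\<close>, and
        \<open>e \<le> 1\<close> turns this into a true distance.\<close>
      have near: "\<exists>b\<in>B'. d p b < e"
        if "p \<in> A'" "A' \<in> topspace (Law X)" "B' \<in> topspace (Law X)" "\<bar>f p A' - f p B'\<bar> < e" for p A' B'
      proof -
        have "p \<in> M" using that by (auto simp: topspace_Law topX)
        then have "f p A' \<le> 0" using f_le[OF that(2,1), of p] by simp
        then have "f p B' < e" using that by linarith
        moreover have "\<exists>b\<in>B'. f p B' = min 1 (d p b)" using attained that(3) .
        ultimately show ?thesis using e1 by (metis min_less_iff_disj not_less)
      qed
      have AB: "\<exists>b\<in>B. d a b < e" if "a \<in> A" for a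
        using near[OF that A B] close that AM by blast
      have BA: "\<exists>a\<in>A. d a b < e" if "b \<in> B" for b
      proof -
        have "b \<in> M" using that B by (auto simp: topspace_Law topX)
        then show ?thesis using near[OF that B A] close by (metis abs_minus_commute commute imageI)
      qed
      have BM: "B \<subseteq> M" "finite B" "B \<noteq> {}" using B by (auto simp: topspace_Law topX)
      have in_ball: "b \<in> mball a (r a)" if "a \<in> A" "b \<in> B" "d a b < e" for a b
        using that AM BM e(2)[of a] by (auto simp: in_mball)
      have "B \<subseteq> \<Union>\<U>"
      proof
        fix b assume "b \<in> B"
        then obtain a where a: "a \<in> A" "d a b < e" using BA by blast
        then obtain U where "U \<in> \<U>" "a \<in> U" using \<U>(4) by (auto simp: vietoris_basic_def)
        then show "b \<in> \<Union>\<U>" using in_ball[OF a(1) \<open>b \<in> B\<close> a(2)] r[OF a(1)] by blast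
      qed
      moreover have "B \<inter> U \<noteq> {}" if "U \<in> \<U>" for U
      proof -
        have "A \<inter> U \<noteq> {}" using \<U>(4) that by (auto simp: vietoris_basic_def)
        then obtain a where a: "a \<in> A" "a \<in> U" by blast
        then obtain b where b: "b \<in> B" "d a b < e" using AB by blast
        then show ?thesis using in_ball[OF a(1) b] r[OF a(1)] that a by blast
      qed
      ultimately show ?thesis using \<U>(5) BM by (auto simp: vietoris_basic_def)
    qed
    then show "\<exists>e>0. \<forall>B\<in>topspace (Law X). (\<forall>g\<in>f ` M. \<bar>g A - g B\<bar> < e) \<longrightarrow> B \<in> W"
      using e(1) by blast
  qed
qed

lemma metrizable_space_Law_iff: "metrizable_space (Law X) \<longleftrightarrow> metrizable_space X"
  using metrizable_space_Law metrizable_space_subtopology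
    homeomorphic_metrizable_space[OF homeomorphic_space_Law_singletons] by blast

section \<open>Metrization by stratifying networks\<close>

text \<open>The weight (1/2)^k at level k reduces equicontinuity at a point to finitely many levels,
  and local finiteness reduces each of these to finitely many continuous functions. Separation
  survives the weights: if the weighted values at x and y differ by less than (1/2)^k and the
  unweighted value at x is 1, the value at y is nonzero.\<close>

lemma metrizable_space_from_locally_finite_functions:
  fixes X :: "'a topology" and I :: "nat \<Rightarrow> 'i set" and h :: "nat \<Rightarrow> 'i \<Rightarrow> 'a \<Rightarrow> real"
  assumes t1: "t1_space X"
    and locally_finite: "\<And>k x. x \<in> topspace X \<Longrightarrow>
      \<exists>V. openin X V \<and> x \<in> V \<and> finite {i \<in> I k. B k i \<inter> V \<noteq> {}}"
    and continuous: "\<And>k i. i \<in> I k \<Longrightarrow> continuous_map X (top_of_set {0..1}) (h k i)"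
    and vanishing: "\<And>k i y. i \<in> I k \<Longrightarrow> y \<in> topspace X - B k i \<Longrightarrow> h k i y = 0"
    and separating: "\<And>U x. openin X U \<Longrightarrow> x \<in> U \<Longrightarrow> \<exists>k. \<exists>i\<in>I k. h k i x = 1 \<and> B k i \<subseteq> U"
  shows "metrizable_space X"
proof -
  define F where "F = {\<lambda>x. (1/2)^k * h k i x | k i. i \<in> I k}"
  have h01: "0 \<le> h k i x" "h k i x \<le> 1" if i: "i \<in> I k" and x: "x \<in> topspace X" for k i x
  proof -
    have "h k i x \<in> {0..1}"
      using continuous[OF i] x by (auto simp: continuous_map_in_subtopology)
    then show "0 \<le> h k i x" "h k i x \<le> 1" by auto
  qed
  show ?thesis
  proof (rule metrizable_space_from_functions[OF t1, of F])
    fix f x assume "f \<in> F" and x: "x \<in> topspace X"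
    then obtain k i where i: "i \<in> I k" and f: "f = (\<lambda>x. (1/2)^k * h k i x)"
      unfolding F_def by blast
    have "(1/2::real)^k * h k i x \<le> 1 * 1"
      using h01[OF i x] by (intro mult_mono power_le_one) auto
    then show "f x \<in> {0..1}" using h01[OF i x] by (simp add: f)
  next
    fix x and e :: real assume x: "x \<in> topspace X" and e: "e > 0"
    obtain K where K: "(1/2)^K < e" using real_arch_pow_inv[of e "1/2"] e by auto
    have "\<forall>k. \<exists>V. openin X V \<and> x \<in> V \<and> finite {i \<in> I k. B k i \<inter> V \<noteq> {}}"
      using locally_finite[OF x] ..
    from choice[OF this] obtain V
      where V: "\<And>k. openin X (V k) \<and> x \<in> V k \<and> finite {i \<in> I k. B k i \<inter> V k \<noteq> {}}" by auto
    \<comment> \<open>Functions of level \<open>k\<close> with index outside \<open>\<Phi> k\<close>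
      vanish throughout \<open>V k\<close>, in particular at \<open>x\<close>, so continuity has to
      control only the finitely many others.\<close>
    define \<Phi> where "\<Phi> k = {i \<in> I k. B k i \<inter> V k \<noteq> {}}" for k
    define W where "W k i = {y \<in> topspace X. h k i y \<in> {h k i x - e <..< h k i x + e}}" for k i
    have W: "openin X (W k i)" "x \<in> W k i" if "i \<in> I k" for k i
    proof -
      have "continuous_map X euclideanreal (h k i)"
        using continuous[OF that] by (simp add: continuous_map_in_subtopology)
      then show "openin X (W k i)"
        unfolding W_def by (rule openin_continuous_map_preimage) simp
      show "x \<in> W k i" using x e by (simp add: W_def)
    qed
    \<comment> \<open>The intersections with the whole space cover the case of an empty index
      set.\<close>
    define T where "T = topspace X \<inter> (\<Inter>k\<in>{..<K}. V k \<inter> (topspace X \<inter> (\<Inter>i\<in>\<Phi> k. W k i)))"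
    have "openin X (topspace X \<inter> (\<Inter>i\<in>\<Phi> k. W k i))" for k
      using V[of k] W by (intro openin_Int_Inter) (auto simp: \<Phi>_def)
    then have "openin X T"
      unfolding T_def using V by (intro openin_Int_Inter) auto
    moreover have "x \<in> T" using V W x by (auto simp: T_def \<Phi>_def)
    moreover have "\<bar>f x - f y\<bar> \<le> e" if y: "y \<in> T" and f: "f \<in> F" for f y
    proof -
      obtain k i where i: "i \<in> I k" and f: "f = (\<lambda>x. (1/2)^k * h k i x)"
        using f unfolding F_def by blast
      have yX: "y \<in> topspace X" using y by (simp add: T_def)
      have fxy: "\<bar>f x - f y\<bar> = (1/2)^k * \<bar>h k i x - h k i y\<bar>"
        by (simp add: f abs_mult flip: right_diff_distrib)
      have d1: "\<bar>h k i x - h k i y\<bar> \<le> 1" using h01[OF i x] h01[OF i yX] by auto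
      show ?thesis
      proof (cases "k < K")
        case False
        have "\<bar>f x - f y\<bar> \<le> (1/2)^k * 1" unfolding fxy using d1 by (intro mult_left_mono) auto
        also have "\<dots> \<le> (1/2)^K" using False by (simp add: power_decreasing)
        finally show ?thesis using K by simp
      next
        case True
        have "\<bar>h k i x - h k i y\<bar> \<le> e"
        proof (cases "i \<in> \<Phi> k")
          case True
          then have "y \<in> W k i" using y \<open>k < K\<close> by (auto simp: T_def)
          then show ?thesis by (auto simp: W_def)
        next
          case False
          then have "x \<notin> B k i" "y \<notin> B k i"
            using i V[of k] y \<open>k < K\<close> by (auto simp: \<Phi>_def T_def)
          then show ?thesis using vanishing[OF i] x yX e by simp
        qed
        then have "(1/2)^k * \<bar>h k i x - h k i y\<bar> \<le> 1 * e"
          by (intro mult_mono power_le_one) auto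
        then show ?thesis by (simp add: fxy)
      qed
    qed
    ultimately show "\<exists>V. openin X V \<and> x \<in> V \<and> (\<forall>y\<in>V. \<forall>f\<in>F. \<bar>f x - f y\<bar> \<le> e)" by blast
  next
    fix x U assume "openin X U" "x \<in> U"
    from separating[OF this] obtain k i where i: "i \<in> I k" "h k i x = 1" "B k i \<subseteq> U" by blast
    have "y \<in> U" if "y \<in> topspace X" "\<forall>f\<in>F. \<bar>f x - f y\<bar> < (1/2)^k" for y
    proof -
      have "(\<lambda>x. (1/2)^k * h k i x) \<in> F" using i(1) unfolding F_def by blast
      from bspec[OF that(2) this] have "\<bar>(1/2)^k * h k i x - (1/2)^k * h k i y\<bar> < (1/2)^k" .
      then have "h k i y \<noteq> 0" using i(2) by auto
      then have "y \<in> B k i" using vanishing[OF i(1)] that(1) by blast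
      then show ?thesis using i(3) by blast
    qed
    then show "\<exists>e>0. \<forall>y\<in>topspace X. (\<forall>f\<in>F. \<bar>f x - f y\<bar> < e) \<longrightarrow> y \<in> U"
      by (intro exI[of _ "(1/2)^k"]) simp
  qed
qed

text \<open>The \<open>star\<close> condition makes \<open>U \<mapsto> interior (P n U)\<close> a stratification of \<open>X\<close>.\<close>

locale star_network =
  fixes X :: "'a topology" and N :: "nat \<Rightarrow> 'a set set"
  assumes locally_finite: "\<And>n. locally_finite_in X (N n)"
    and closed: "\<And>n A. A \<in> N n \<Longrightarrow> closedin X A"
    and increasing: "\<And>n. N n \<subseteq> N (Suc n)"
    and star: "\<And>U x. openin X U \<Longrightarrow> x \<in> U \<Longrightarrow> \<exists>n. x \<in> X interior_of \<Union>{A \<in> N n. A \<subseteq> U}"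
begin

definition P :: "nat \<Rightarrow> 'a set \<Rightarrow> 'a set" where
  "P n U = \<Union>{A \<in> N n. A \<subseteq> U}"

lemma P_subset: "P n U \<subseteq> U"
  by (auto simp: P_def)

lemma P_mono: "m \<le> n \<Longrightarrow> P m U \<subseteq> P n U"
  using lift_Suc_mono_le[of N m n] increasing by (fastforce simp: P_def)

lemma closedin_P: "closedin X (P n U)"
  unfolding P_def
  by (rule closedin_locally_finite_Union)
    (auto simp: closed intro: locally_finite_in_subset[OF locally_finite[of n]])

lemma interior_P: "openin X U \<Longrightarrow> x \<in> U \<Longrightarrow> \<exists>n. x \<in> X interior_of P n U"
  using star by (simp add: P_def)

lemma local_finiteness:
  assumes "x \<in> topspace X"
  obtains V where "openin X V" "x \<in> V" "finite {A \<in> N n. A \<inter> V \<noteq> {}}"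
  using locally_finite[of n] assms unfolding locally_finite_in_def by meson

text \<open>\<open>O1\<close> collects points that have reached \<open>P n\<close> of the complement
  of T at a level where they have not yet reached \<open>P n\<close> of the complement of S, and
  \<open>O2\<close> does the reverse. Since \<open>P n\<close> increases with n, no point does
  both.\<close>

lemma normal_space: "normal_space X"
  unfolding normal_space_def
proof (intro allI impI)
  fix S T assume ST: "closedin X S \<and> closedin X T \<and> disjnt S T"
  define O1 where "O1 = (\<Union>n. X interior_of P n (topspace X - T) - P n (topspace X - S))"
  define O2 where "O2 = (\<Union>n. X interior_of P n (topspace X - S) - P n (topspace X - T))"
  have op: "openin X O1" "openin X O2"
    unfolding O1_def O2_def by (auto intro!: openin_Union openin_diff closedin_P)
  have cover: "C \<subseteq> (\<Union>n. X interior_of P n (topspace X - D) - P n (topspace X - C))"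
    if C: "closedin X C" and D: "closedin X D" and CD: "disjnt C D" for C D
  proof
    fix x assume "x \<in> C"
    then have "x \<in> topspace X - D"
      using CD closedin_subset[OF C] by (auto simp: disjnt_iff)
    then obtain n where "x \<in> X interior_of P n (topspace X - D)"
      using interior_P[of "topspace X - D" x] D by blast
    moreover have "x \<notin> P n (topspace X - C)" using P_subset \<open>x \<in> C\<close> by fastforce
    ultimately show "x \<in> (\<Union>n. X interior_of P n (topspace X - D) - P n (topspace X - C))" by blast
  qed
  from cover[of S T] cover[of T S] have "S \<subseteq> O1" "T \<subseteq> O2"
    using ST by (auto simp: O1_def O2_def disjnt_sym)
  moreover have "disjnt O1 O2"
  proof (rule ccontr)
    assume "\<not> disjnt O1 O2"
    then obtain y where "y \<in> O1" "y \<in> O2" by (auto simp: disjnt_iff)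
    from \<open>y \<in> O1\<close> obtain m where m: "y \<in> P m (topspace X - T)" "y \<notin> P m (topspace X - S)"
      using interior_of_subset[of X] unfolding O1_def by blast
    from \<open>y \<in> O2\<close> obtain n where n: "y \<in> P n (topspace X - S)" "y \<notin> P n (topspace X - T)"
      using interior_of_subset[of X] unfolding O2_def by blast
    show False
    proof (cases "m \<le> n")
      case True
      with m n P_mono show False by blast
    next
      case False
      then have "n \<le> m" by simp
      with m n P_mono show False by blast
    qed
  qed
  ultimately show "\<exists>U V. openin X U \<and> openin X V \<and> S \<subseteq> U \<and> T \<subseteq> V \<and> disjnt U V"
    using op by (intro exI[of _ O1] exI[of _ O2]) simp
qed

text \<open>The cells \<open>C - R m\<close> below form a locally finite closed cover of \<open>X\<close>, each meeting only finitely
  many members of \<open>N n\<close>; removing from \<open>X\<close> all cells that miss \<open>A\<close> expands \<open>A\<close>.\<close>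

lemma locally_finite_expansion:
  "\<exists>E. (\<forall>A\<in>N n. openin X (E A) \<and> A \<subseteq> E A) \<and>
      (\<forall>x\<in>topspace X. \<exists>V. openin X V \<and> x \<in> V \<and> finite {A \<in> N n. E A \<inter> V \<noteq> {}})"
proof -
  define good where "good C \<longleftrightarrow> finite {A \<in> N n. A \<inter> C \<noteq> {}}" for C
  define Q where "Q m = \<Union>{C \<in> N m. good C}" for m
  \<comment> \<open>Subtracting the interiors of all earlier \<open>Q k\<close> makes the cells
    locally finite: on the interior of \<open>Q k\<close> only cells of level at most
    \<open>k\<close> survive.\<close>
  define R where "R m = (\<Union>k<m. X interior_of Q k)" for m
  define E where "E A = topspace X - \<Union>{C - R m | m C. C \<in> N m \<and> good C \<and> (C - R m) \<inter> A = {}}" for A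
  have closed_cell: "closedin X (C - R m)" if "C \<in> N m" for C m
    using closed[OF that] by (auto simp: R_def intro!: closedin_diff openin_Union)
  have Q_cover: "\<exists>k. x \<in> X interior_of Q k" if x: "x \<in> topspace X" for x
  proof -
    obtain W where W: "openin X W" "x \<in> W" "finite {A \<in> N n. A \<inter> W \<noteq> {}}"
      using local_finiteness[OF x] .
    then obtain k where k: "x \<in> X interior_of P k W" using interior_P by blast
    have "good C" if "C \<subseteq> W" for C
      unfolding good_def by (rule finite_subset[OF _ W(3)]) (use that in blast)
    then have "P k W \<subseteq> Q k" by (auto simp: P_def Q_def)
    then show ?thesis using k interior_of_mono by blast
  qed
  \<comment> \<open>That \<open>V\<close> meets only cells indexed by the finite \<open>Z\<close>
    gives openness of \<open>E A\<close>; that these cells cover \<open>V\<close> gives local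
    finiteness of the expansion.\<close>
  have main: "\<exists>V Z. openin X V \<and> x \<in> V \<and> finite Z \<and>
      Z \<subseteq> {(m, C). C \<in> N m \<and> good C} \<and> V \<subseteq> (\<Union>(m, C)\<in>Z. C - R m) \<and>
      (\<forall>m C. C \<in> N m \<longrightarrow> good C \<longrightarrow> (C - R m) \<inter> V \<noteq> {} \<longrightarrow> (m, C) \<in> Z)"
    if x: "x \<in> topspace X" for x
  proof -
    obtain k where k: "x \<in> X interior_of Q k" using Q_cover[OF x] by blast
    have "\<forall>m. \<exists>V. openin X V \<and> x \<in> V \<and> finite {A \<in> N m. A \<inter> V \<noteq> {}}"
      using locally_finite x unfolding locally_finite_in_def by auto
    from choice[OF this] obtain V
      where V: "\<And>m. openin X (V m) \<and> x \<in> V m \<and> finite {A \<in> N m. A \<inter> V m \<noteq> {}}" by auto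
    define W where "W = X interior_of Q k \<inter> (\<Inter>m\<in>{..k}. V m)"
    define Z where "Z = {(m, C). C \<in> N m \<and> good C \<and> (C - R m) \<inter> W \<noteq> {}}"
    have "Z \<subseteq> Sigma {..k} (\<lambda>m. {A \<in> N m. A \<inter> V m \<noteq> {}})"
    proof clarify
      fix m C assume "(m, C) \<in> Z"
      then obtain y where y: "C \<in> N m" "y \<in> C" "y \<notin> R m" "y \<in> W" by (auto simp: Z_def)
      have "m \<le> k"
      proof (rule ccontr)
        assume "\<not> m \<le> k"
        then have "X interior_of Q k \<subseteq> R m" unfolding R_def by (intro UN_upper) simp
        then show False using y by (auto simp: W_def)
      qed
      moreover from this have "y \<in> V m" using y by (auto simp: W_def)
      ultimately show "m \<in> {..k} \<and> C \<in> {A \<in> N m. A \<inter> V m \<noteq> {}}" using y by auto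
    qed
    then have "finite Z" using V by (elim finite_subset) auto
    moreover have "openin X W"
      unfolding W_def using V by (intro openin_Int_Inter openin_Int openin_Inter) auto
    moreover have "x \<in> W" using V k by (auto simp: W_def)
    moreover have "W \<subseteq> (\<Union>(m, C)\<in>Z. C - R m)"
    proof
      fix y assume y: "y \<in> W"
      then have "y \<in> Q k" using interior_of_subset by (fastforce simp: W_def)
      \<comment> \<open>At the least level with \<open>y\<close> in \<open>Q m\<close>, no earlier
        interior contains \<open>y\<close>, so \<open>y\<close> survives in a cell of that
        level.\<close>
      define m where "m = (LEAST m. y \<in> Q m)"
      have m: "y \<in> Q m" unfolding m_def using \<open>y \<in> Q k\<close> by (rule LeastI)
      have "y \<notin> R m"
      proof
        assume "y \<in> R m"
        then obtain j where "j < m" "y \<in> X interior_of Q j" by (auto simp: R_def)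
        then have "j < m" "y \<in> Q j" using interior_of_subset by fast+
        then show False using not_less_Least unfolding m_def by blast
      qed
      moreover obtain C where "C \<in> N m" "good C" "y \<in> C" using m by (auto simp: Q_def)
      ultimately show "y \<in> (\<Union>(m, C)\<in>Z. C - R m)"
        using y by (intro UN_I[of "(m, C)"]) (auto simp: Z_def)
    qed
    ultimately show ?thesis
      by (intro exI[of _ W] exI[of _ Z]) (auto simp: Z_def)
  qed
  show ?thesis
  proof (intro exI[of _ E] conjI ballI)
    fix A assume A: "A \<in> N n"
    show "A \<subseteq> E A"
      using closedin_subset[OF closed[OF A]] by (auto simp: E_def)
    show "openin X (E A)"
    proof (subst openin_subopen, intro ballI)
      fix x assume x: "x \<in> E A"
      then have "x \<in> topspace X" by (simp add: E_def)
      from main[OF this] obtain V Z where V: "openin X V" "x \<in> V" "finite Z"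
        "Z \<subseteq> {(m, C). C \<in> N m \<and> good C}"
        "\<forall>m C. C \<in> N m \<longrightarrow> good C \<longrightarrow> (C - R m) \<inter> V \<noteq> {} \<longrightarrow> (m, C) \<in> Z" by auto
      \<comment> \<open>Inside \<open>V\<close>, the part removed from the space to form
        \<open>E A\<close> is contained in this finite union of closed cells.\<close>
      define D where "D = (\<Union>(m, C)\<in>{(m, C) \<in> Z. (C - R m) \<inter> A = {}}. C - R m)"
      have "finite {(m, C) \<in> Z. (C - R m) \<inter> A = {}}"
        by (rule finite_subset[OF _ V(3)]) auto
      then have "closedin X D"
        unfolding D_def using V(4) closed_cell by (intro closedin_Union) auto
      then have "openin X (V - D)" using V(1) by blast
      moreover have "x \<in> V - D"
      proof
        show "x \<notin> D"
        proof
          assume "x \<in> D"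
          then obtain m C where C: "(m, C) \<in> Z" "(C - R m) \<inter> A = {}" "x \<in> C - R m"
            unfolding D_def by auto
          then have "C \<in> N m" "good C" using V(4) by auto
          then show False using C(2,3) x unfolding E_def by blast
        qed
      qed (fact V(2))
      moreover have "V - D \<subseteq> E A"
      proof
        fix y assume y: "y \<in> V - D"
        have "y \<notin> C - R m" if "C \<in> N m" "good C" "(C - R m) \<inter> A = {}" for m C
        proof
          assume "y \<in> C - R m"
          then have "(m, C) \<in> Z" using V(5) that y by blast
          then have "y \<in> D" using that \<open>y \<in> C - R m\<close> unfolding D_def by blast
          then show False using y by blast
        qed
        then show "y \<in> E A" using y openin_subset[OF V(1)] unfolding E_def by blast
      qed
      ultimately show "\<exists>T. openin X T \<and> x \<in> T \<and> T \<subseteq> E A" by blast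
    qed
  next
    fix x assume "x \<in> topspace X"
    from main[OF this] obtain V Z where V: "openin X V" "x \<in> V" "finite Z"
      "Z \<subseteq> {(m, C). C \<in> N m \<and> good C}" "V \<subseteq> (\<Union>(m, C)\<in>Z. C - R m)" by auto
    \<comment> \<open>A point of \<open>E A\<close> in \<open>V\<close> lies in a cell from
      \<open>Z\<close>. That cell was not removed, so it meets \<open>A\<close>, and
      \<open>A\<close> is one of the finitely many members of \<open>N n\<close> meeting the good
      set \<open>C\<close>.\<close>
    have "{A \<in> N n. E A \<inter> V \<noteq> {}} \<subseteq> (\<Union>(m, C)\<in>Z. {A \<in> N n. A \<inter> C \<noteq> {}})"
    proof
      fix A assume "A \<in> {A \<in> N n. E A \<inter> V \<noteq> {}}"
      then obtain y where y: "A \<in> N n" "y \<in> E A" "y \<in> V" by blast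
      then obtain m C where C: "(m, C) \<in> Z" "y \<in> C - R m" using V(5) by blast
      then have "C \<in> N m" "good C" using V(4) by auto
      then have "(C - R m) \<inter> A \<noteq> {}" using y(2) C(2) unfolding E_def by blast
      then have "A \<in> {A \<in> N n. A \<inter> C \<noteq> {}}" using y(1) by blast
      then show "A \<in> (\<Union>(m, C)\<in>Z. {A \<in> N n. A \<inter> C \<noteq> {}})" using C(1) by blast
    qed
    moreover have "finite (\<Union>(m, C)\<in>Z. {A \<in> N n. A \<inter> C \<noteq> {}})"
      using V(3,4) by (auto simp: good_def)
    ultimately show "\<exists>V. openin X V \<and> x \<in> V \<and> finite {A \<in> N n. E A \<inter> V \<noteq> {}}"
      using V(1,2) finite_subset by blast
  qed
qed

text \<open>Finite subfamilies of a level, cut down by the open expansions, yield a \<sigma>-locally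
  finite base; normality then provides Urysohn functions supported in its members.\<close>

lemma metrizable_space:
  assumes "t1_space X"
  shows "metrizable_space X"
proof -
  have "\<forall>n. \<exists>E. (\<forall>A\<in>N n. openin X (E A) \<and> A \<subseteq> E A) \<and>
      (\<forall>x\<in>topspace X. \<exists>V. openin X V \<and> x \<in> V \<and> finite {A \<in> N n. E A \<inter> V \<noteq> {}})"
    using locally_finite_expansion ..
  from choice[OF this] obtain E where "\<forall>n. (\<forall>A\<in>N n. openin X (E n A) \<and> A \<subseteq> E n A) \<and>
      (\<forall>x\<in>topspace X. \<exists>V. openin X V \<and> x \<in> V \<and> finite {A \<in> N n. E n A \<inter> V \<noteq> {}})" ..
  then have E: "\<And>n A. A \<in> N n \<Longrightarrow> openin X (E n A) \<and> A \<subseteq> E n A"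
    and lf_E: "\<And>n x. x \<in> topspace X \<Longrightarrow>
      \<exists>V. openin X V \<and> x \<in> V \<and> finite {A \<in> N n. E n A \<inter> V \<noteq> {}}"
    by auto
  \<comment> \<open>The interior of the union keeps the set inside any set that contains all members
    of \<open>F\<close>. The expansions give local finiteness: \<open>B n F\<close> meets
    \<open>V\<close> only if \<open>E n A\<close> meets \<open>V\<close> for every \<open>A\<close>
    in \<open>F\<close>.\<close>
  define B where "B n F = X interior_of (\<Union>F) \<inter> (\<Inter>A\<in>F. E n A)" for n F
  define J where "J n = {F. finite F \<and> F \<noteq> {} \<and> F \<subseteq> N n}" for n
  have open_B: "openin X (B n F)" if "F \<in> J n" for n F
    unfolding B_def using that E by (intro openin_Int openin_Inter) (auto simp: J_def)
  have lf_B: "\<exists>V. openin X V \<and> x \<in> V \<and> finite {F \<in> J n. B n F \<inter> V \<noteq> {}}"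
    if x: "x \<in> topspace X" for x n
  proof -
    obtain V where V: "openin X V" "x \<in> V" "finite {A \<in> N n. E n A \<inter> V \<noteq> {}}"
      using lf_E[OF x] by blast
    have "{F \<in> J n. B n F \<inter> V \<noteq> {}} \<subseteq> Pow {A \<in> N n. E n A \<inter> V \<noteq> {}}"
      by (auto simp: J_def B_def)
    then have "finite {F \<in> J n. B n F \<inter> V \<noteq> {}}" using V(3) finite_subset by blast
    then show ?thesis using V by blast
  qed
  have base_B: "\<exists>n. \<exists>F\<in>J n. x \<in> B n F \<and> B n F \<subseteq> U" if U: "openin X U" "x \<in> U" for x U
  proof -
    have x: "x \<in> topspace X" using U openin_subset by blast
    obtain n where n: "x \<in> X interior_of P n U" using interior_P[OF U] by blast
    obtain V where V: "openin X V" "x \<in> V" "finite {A \<in> N n. A \<inter> V \<noteq> {}}"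
      using local_finiteness[OF x] .
    define F where "F = {A \<in> N n. A \<subseteq> U \<and> x \<in> A}"
    \<comment> \<open>Removing the finitely many closed members that meet \<open>V\<close> but miss
      \<open>x\<close> leaves a neighbourhood of \<open>x\<close>, within the interior of
      \<open>P n U\<close>, covered by \<open>F\<close> alone.\<close>
    define D where "D = \<Union>{A \<in> N n. A \<inter> V \<noteq> {} \<and> x \<notin> A}"
    have "finite {A \<in> N n. A \<inter> V \<noteq> {} \<and> x \<notin> A}" by (rule finite_subset[OF _ V(3)]) auto
    then have "closedin X D" unfolding D_def using closed by (intro closedin_Union) auto
    then have "openin X (X interior_of P n U \<inter> V - D)"
      using V(1) by (intro openin_diff openin_Int openin_interior_of)
    moreover have "X interior_of P n U \<inter> V - D \<subseteq> \<Union>F"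
    proof
      fix y assume y: "y \<in> X interior_of P n U \<inter> V - D"
      then have "y \<in> P n U" using interior_of_subset by fastforce
      then obtain A where "A \<in> N n" "A \<subseteq> U" "y \<in> A" by (auto simp: P_def)
      moreover then have "x \<in> A" using y by (auto simp: D_def)
      ultimately show "y \<in> \<Union>F" by (auto simp: F_def)
    qed
    moreover have "x \<in> X interior_of P n U \<inter> V - D" using n V by (auto simp: D_def)
    ultimately have int: "x \<in> X interior_of (\<Union>F)" unfolding interior_of_def by blast
    then have "x \<in> \<Union>F" using interior_of_subset by fast
    moreover have "finite F" by (rule finite_subset[OF _ V(3)]) (use V(2) in \<open>auto simp: F_def\<close>)
    ultimately have "F \<in> J n" by (auto simp: J_def F_def)
    moreover have "x \<in> B n F" using int E by (fastforce simp: B_def F_def)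
    moreover have "B n F \<subseteq> U"
      using interior_of_subset[of X "\<Union>F"] by (auto simp: B_def F_def)
    ultimately show ?thesis by blast
  qed
  \<comment> \<open>The interiors of the closed sets \<open>P m (B n F)\<close> exhaust
    \<open>B n F\<close> as \<open>m\<close> varies, so each of its points receives the value 1 for
    some \<open>m\<close>.\<close>
  define bump where "bump n m F f \<longleftrightarrow> continuous_map X (top_of_set {0..1::real}) f \<and>
      f ` (topspace X - B n F) \<subseteq> {0} \<and> f ` P m (B n F) \<subseteq> {1}" for n m F f
  define h where "h n m F = (SOME f. bump n m F f)" for n m F
  have h: "bump n m F (h n m F)" if F: "F \<in> J n" for n m F
  proof -
    have "closedin X (topspace X - B n F)" using open_B[OF F] by blast
    moreover have "disjnt (topspace X - B n F) (P m (B n F))"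
      using P_subset by (fastforce simp: disjnt_iff)
    ultimately have "\<exists>f. bump n m F f"
      unfolding bump_def
      by (rule Urysohn_lemma[OF normal_space _ closedin_P, of "topspace X - B n F" m "B n F" 0 1]) auto
    then show ?thesis unfolding h_def by (rule someI_ex)
  qed
  \<comment> \<open>A single level index codes the pair of the network level \<open>n\<close> and
    the stratification level \<open>m\<close>.\<close>
  define nn where "nn k = fst (prod_decode k)" for k
  define mm where "mm k = snd (prod_decode k)" for k
  show ?thesis
  proof (rule metrizable_space_from_locally_finite_functions[OF assms,
        where I="\<lambda>k. J (nn k)" and B="\<lambda>k. B (nn k)" and h="\<lambda>k. h (nn k) (mm k)"])
    show "\<exists>V. openin X V \<and> x \<in> V \<and> finite {F \<in> J (nn k). B (nn k) F \<inter> V \<noteq> {}}"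
      if "x \<in> topspace X" for k x using lf_B[OF that] .
    show "continuous_map X (top_of_set {0..1}) (h (nn k) (mm k) F)" if "F \<in> J (nn k)" for k F
      using h[OF that] by (simp add: bump_def)
    show "h (nn k) (mm k) F y = 0" if "F \<in> J (nn k)" "y \<in> topspace X - B (nn k) F" for k F y
      using h[OF that(1), of "mm k"] that(2) unfolding bump_def by blast
    show "\<exists>k. \<exists>F\<in>J (nn k). h (nn k) (mm k) F x = 1 \<and> B (nn k) F \<subseteq> U"
      if U: "openin X U" "x \<in> U" for U x
    proof -
      obtain n F where F: "F \<in> J n" "x \<in> B n F" "B n F \<subseteq> U" using base_B[OF U] by blast
      obtain m where "x \<in> X interior_of P m (B n F)" using interior_P[OF open_B[OF F(1)] F(2)] by blast
      then have "x \<in> P m (B n F)" using interior_of_subset by fast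
      then have "h n m F x = 1" using h[OF F(1), of m] unfolding bump_def by blast
      then show ?thesis
        using F by (intro exI[of _ "prod_encode (n, m)"] bexI[of _ F]) (auto simp: nn_def mm_def)
    qed
  qed
qed

end

section \<open>Sequential spaces and strong neighbourhoods in the hyperspace\<close>

lemma regular_space_shrink:
  assumes "regular_space X" "openin X U" "x \<in> U"
  shows "\<exists>V. openin X V \<and> x \<in> V \<and> X closure_of V \<subseteq> U"
proof -
  have "closedin X (topspace X - U)" "x \<in> topspace X - (topspace X - U)"
    using assms openin_subset by auto
  then obtain V where "openin X V" "x \<in> V" "disjnt (topspace X - U) (X closure_of V)"
    using assms(1) unfolding regular_space by blast
  then show ?thesis
    using closure_of_subset_topspace[of X V] by (auto simp: disjnt_iff)
qed

text \<open>The complement of a non-isolated point is not closed, so a sequence in it converges to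
  that point; its range is infinite, since a finite range would be closed by T1.\<close>

lemma sequential_space_injective_sequence:
  assumes t1: "t1_space X" and seq: "sequential_space X"
    and x: "x \<in> topspace X" "\<not> openin X {x}"
  obtains s :: "nat \<Rightarrow> 'a" where "inj s" "range s \<subseteq> topspace X - {x}" "limitin X s x sequentially"
proof -
  have "topspace X - (topspace X - {x}) = {x}" using x(1) by blast
  then have "\<not> closedin X (topspace X - {x})" using x(2) by (simp add: closedin_def)
  then obtain t l where t: "range t \<subseteq> topspace X - {x}" "l \<in> topspace X - (topspace X - {x})"
      "limitin X t l sequentially"
    using seq unfolding sequential_space_def by blast
  have lim: "limitin X t x sequentially" using t(2,3) by simp
  have cofinite: "finite {n. t n \<notin> U}" if "openin X U" "x \<in> U" for U
    using limitinD[OF lim that] unfolding cofinite_eq_sequentially[symmetric] eventually_cofinite .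
  have "infinite (range t)"
  proof
    assume fin: "finite (range t)"
    then have "openin X (topspace X - range t)"
      using t1 t(1) by (auto simp: t1_space_closedin_finite intro!: openin_diff)
    then have "finite {n. t n \<notin> topspace X - range t}" using cofinite x(1) t(1) by blast
    moreover have "{n. t n \<notin> topspace X - range t} = UNIV" by auto
    ultimately show False by simp
  qed
  \<comment> \<open>\<open>s\<close> need not be a subsequence of \<open>t\<close>: it lists
    infinitely many values in any order. Convergence only asks that each neighbourhood of
    \<open>x\<close> omit finitely many terms.\<close>
  then obtain s :: "nat \<Rightarrow> 'a" where s: "inj s" "range s \<subseteq> range t"
    using infinite_countable_subset by blast
  have "limitin X s x sequentially"
    unfolding limitin_def
  proof (intro conjI allI impI)
    fix U assume U: "openin X U \<and> x \<in> U"
    have "s ` {j. s j \<notin> U} \<subseteq> t ` {n. t n \<notin> U}"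
    proof clarify
      fix j assume j: "s j \<notin> U"
      have "s j \<in> range t" using s(2) by auto
      then obtain n where "s j = t n" by blast
      then show "s j \<in> t ` {n. t n \<notin> U}" using j by auto
    qed
    then have "finite (s ` {j. s j \<notin> U})" using cofinite U by (meson finite_imageI finite_subset)
    then have "finite {j. s j \<notin> U}" using s(1) by (meson finite_imageD inj_on_subset subset_UNIV)
    then show "\<forall>\<^sub>F n in sequentially. s n \<in> U"
      unfolding cofinite_eq_sequentially[symmetric] eventually_cofinite .
  qed (fact x(1))
  then show thesis using s t(1) that by blast
qed

text \<open>The points in closures of countable subsets of \<open>A\<close> form a set closed under
  sequential limits, since countable unions of countable sets are countable; sequentiality makes it
  closed.\<close>

lemma sequential_space_countable_tightness:
  assumes seq: "sequential_space X" and A: "A \<subseteq> topspace X" and x: "x \<in> X closure_of A"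
  shows "\<exists>C. countable C \<and> C \<subseteq> A \<and> x \<in> X closure_of C"
proof -
  define T where "T = {y. \<exists>C. countable C \<and> C \<subseteq> A \<and> y \<in> X closure_of C}"
  have "closedin X T"
  proof (rule ccontr)
    assume "\<not> closedin X T"
    moreover have "T \<subseteq> topspace X" using closure_of_subset_topspace by (fastforce simp: T_def)
    ultimately obtain s l where s: "range s \<subseteq> T" "l \<in> topspace X - T" "limitin X s l sequentially"
      using seq unfolding sequential_space_def by blast
    then have "\<forall>n. \<exists>C. countable C \<and> C \<subseteq> A \<and> s n \<in> X closure_of C" by (auto simp: T_def)
    from choice[OF this] obtain C
      where C: "\<And>n. countable (C n) \<and> C n \<subseteq> A \<and> s n \<in> X closure_of C n" by auto
    have "s n \<in> X closure_of (\<Union>n. C n)" for n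
      using C[of n] closure_of_mono[of "C n" "\<Union>n. C n" X] by blast
    then have "l \<in> X closure_of (\<Union>n. C n)"
      using limitin_closedin[OF s(3) closedin_closure_of] by simp
    then have "l \<in> T" using C by (auto simp: T_def intro!: exI[of _ "\<Union>n. C n"])
    then show False using s(2) by blast
  qed
  moreover have "A \<subseteq> T"
  proof
    fix a assume "a \<in> A"
    then have "countable {a} \<and> {a} \<subseteq> A \<and> a \<in> X closure_of {a}"
      using A closure_of_subset[of "{a}" X] by auto
    then show "a \<in> T" unfolding T_def by blast
  qed
  ultimately have "x \<in> T" using x closure_of_minimal by blast
  then show ?thesis by (simp add: T_def)
qed

text \<open>Each term is first separated from the compact set of the limit and the other terms, by
  \<open>C j\<close>. Earlier closures are then subtracted: for i < j the closure of
  \<open>W i\<close> lies in \<open>C i\<close>, which the closure of \<open>W j\<close>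
  avoids.\<close>

lemma convergent_sequence_disjoint_neighbourhoods:
  assumes X: "t1_space X" "regular_space X" and s: "inj s" "range s \<subseteq> topspace X - {x}"
    and lim: "limitin X s x sequentially"
  obtains W :: "nat \<Rightarrow> 'a set" where "\<And>j. openin X (W j)" "\<And>j. s j \<in> W j"
    "\<And>i j. i \<noteq> j \<Longrightarrow> X closure_of W i \<inter> X closure_of W j = {}"
proof -
  have "\<exists>C. openin X C \<and> s j \<in> C \<and> X closure_of C \<subseteq> topspace X - insert x (range s - {s j})" for j
  proof (rule regular_space_shrink[OF X(2)])
    have "compactin X (insert x (range s - {s j}))"
      using s(2) by (intro compactin_sequence_with_limit[OF lim]) auto
    then have "closedin X (insert x (range s - {s j}))"
      using compactin_imp_closedin regular_t1_imp_Hausdorff_space X by blast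
    then show "openin X (topspace X - insert x (range s - {s j}))" by blast
    show "s j \<in> topspace X - insert x (range s - {s j})" using s(2) by auto
  qed
  then have "\<forall>j. \<exists>C. openin X C \<and> s j \<in> C \<and>
      X closure_of C \<subseteq> topspace X - insert x (range s - {s j})" ..
  from choice[OF this] obtain C where C: "\<And>j. openin X (C j)" "\<And>j. s j \<in> C j"
    "\<And>j. X closure_of C j \<subseteq> topspace X - insert x (range s - {s j})" by auto
  have "\<exists>W. openin X W \<and> s j \<in> W \<and> X closure_of W \<subseteq> C j - (\<Union>i<j. X closure_of C i)" for j
  proof (rule regular_space_shrink[OF X(2)])
    show "openin X (C j - (\<Union>i<j. X closure_of C i))"
      using C(1) by (intro openin_diff closedin_Union) auto
    have "s j \<notin> X closure_of C i" if "i < j" for i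
    proof -
      have "s j \<noteq> s i" using s(1) that by (simp add: inj_eq)
      then show ?thesis using C(3)[of i] by blast
    qed
    then show "s j \<in> C j - (\<Union>i<j. X closure_of C i)" using C(2) by auto
  qed
  then have "\<forall>j. \<exists>W. openin X W \<and> s j \<in> W \<and> X closure_of W \<subseteq> C j - (\<Union>i<j. X closure_of C i)" ..
  from choice[OF this] obtain W where W: "\<And>j. openin X (W j)" "\<And>j. s j \<in> W j"
    "\<And>j. X closure_of W j \<subseteq> C j - (\<Union>i<j. X closure_of C i)" by auto
  have lt: "X closure_of W i \<inter> X closure_of W j = {}" if "i < j" for i j
  proof -
    have "C i \<subseteq> X closure_of C i" using closure_of_subset[OF openin_subset[OF C(1)]] .
    then show ?thesis using W(3)[of i] W(3)[of j] that by blast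
  qed
  have "X closure_of W i \<inter> X closure_of W j = {}" if "i \<noteq> j" for i j
    using lt[of i j] lt[of j i] that by (cases "i < j") auto
  then show thesis using W(1,2) that by blast
qed

text \<open>When the closures of the \<open>W j\<close> are disjoint, a finite set meets only finitely many of them; this makes
  the sets below compact-finite in \<open>i\<close>.\<close>

definition Law_trace :: "'a topology \<Rightarrow> (nat \<Rightarrow> 'a set) \<Rightarrow> (nat \<Rightarrow> 'a set) \<Rightarrow> nat \<Rightarrow> 'a set set" where
  "Law_trace X D W k = (case prod_decode k of (n, i) \<Rightarrow>
     {A \<in> topspace (Law X). \<forall>U\<in>insert (D n) (W ` {n..n+i}). A \<inter> U \<noteq> {}})"

text \<open>The index codes a pair (n, i). Only finitely many \<open>D n\<close> meet the union of a
  compact family, as that union is compact. For fixed n, the bound on i comes from covering the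
  family by the open sets of those A that miss the closure of \<open>W j\<close>, for j \<ge>
  n.\<close>

lemma compact_finite_seq_Law_trace:
  assumes D: "compact_finite_seq X D" and W: "\<And>j. openin X (W j)"
    and disjoint: "\<And>i j. i \<noteq> j \<Longrightarrow> X closure_of W i \<inter> X closure_of W j = {}"
  shows "compact_finite_seq (Law X) (Law_trace X D W)"
  unfolding compact_finite_seq_def
proof (intro allI impI)
  fix \<K> assume \<K>: "compactin (Law X) \<K>"
  define T where "T n = {i. \<exists>A\<in>\<K>. \<forall>j\<in>{n..n+i}. A \<inter> W j \<noteq> {}}" for n
  have "finite (T n)" for n
  proof -
    define N where "N j = {A \<in> topspace (Law X). A \<subseteq> topspace X - X closure_of W j}" for j
    have op: "openin (Law X) M" if "M \<in> N ` {n..}" for M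
      using that unfolding N_def by (auto intro!: openin_Law_subset)
    have "\<K> \<subseteq> \<Union>(N ` {n..})"
    proof
      fix A assume "A \<in> \<K>"
      then have A: "A \<in> topspace (Law X)" using compactin_subset_topspace[OF \<K>] by blast
      then have A': "finite A" "A \<subseteq> topspace X" by (auto simp: topspace_Law)
      have "\<exists>j\<ge>n. A \<inter> X closure_of W j = {}"
      proof (rule ccontr)
        assume "\<not> ?thesis"
        then have "\<forall>j\<in>{n..}. \<exists>a. a \<in> A \<inter> X closure_of W j" by auto
        from bchoice[OF this] obtain c where c: "\<And>j. j \<ge> n \<Longrightarrow> c j \<in> A \<inter> X closure_of W j" by auto
        have "inj_on c {n..}"
        proof (rule inj_onI, rule ccontr)
          fix i j assume "i \<in> {n..}" "j \<in> {n..}" "c i = c j" "i \<noteq> j"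
          then show False using c[of i] c[of j] disjoint[of i j] by auto
        qed
        moreover have "c ` {n..} \<subseteq> A" using c by auto
        ultimately have "finite {n..}" using A'(1) inj_on_finite by blast
        then show False by (simp add: infinite_Ici)
      qed
      then show "A \<in> \<Union>(N ` {n..})" using A A' unfolding N_def by blast
    qed
    from compactinD[OF \<K> op this] obtain \<G> where \<G>: "finite \<G>" "\<G> \<subseteq> N ` {n..}" "\<K> \<subseteq> \<Union>\<G>" by auto
    obtain J where J: "J \<subseteq> {n..}" "finite J" "\<G> = N ` J"
      using finite_subset_image[OF \<G>(1,2)] by auto
    have "T n \<subseteq> {..Max J}"
    proof
      fix i assume "i \<in> T n"
      then obtain A where A: "A \<in> \<K>" "\<And>j. j \<in> {n..n+i} \<Longrightarrow> A \<inter> W j \<noteq> {}" by (auto simp: T_def)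
      then obtain j where j: "j \<in> J" "A \<in> N j" using \<G>(3) J(3) by blast
      have "W j \<subseteq> X closure_of W j" using closure_of_subset[OF openin_subset[OF W]] .
      then have "A \<inter> W j = {}" using j(2) unfolding N_def by blast
      then have "j \<notin> {n..n+i}" using A(2) by blast
      then have "i \<le> j" using j(1) J(1) by auto
      also have "j \<le> Max J" using j(1) J(2) by simp
      finally show "i \<in> {..Max J}" by simp
    qed
    then show ?thesis using finite_subset by blast
  qed
  moreover have "finite {n. D n \<inter> \<Union>\<K> \<noteq> {}}"
    using D compactin_Union_Law[OF \<K>] unfolding compact_finite_seq_def by blast
  ultimately have "finite (Sigma {n. D n \<inter> \<Union>\<K> \<noteq> {}} T)" by (rule finite_SigmaI[rotated])
  moreover have "{k. Law_trace X D W k \<inter> \<K> \<noteq> {}} \<subseteq> prod_encode ` Sigma {n. D n \<inter> \<Union>\<K> \<noteq> {}} T"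
  proof
    fix k assume "k \<in> {k. Law_trace X D W k \<inter> \<K> \<noteq> {}}"
    then obtain A where A: "A \<in> Law_trace X D W k" "A \<in> \<K>" by blast
    obtain n i where k: "prod_decode k = (n, i)" by fastforce
    have "A \<inter> D n \<noteq> {}" "\<forall>j\<in>{n..n+i}. A \<inter> W j \<noteq> {}" using A(1) by (auto simp: Law_trace_def k)
    then have "(n, i) \<in> Sigma {n. D n \<inter> \<Union>\<K> \<noteq> {}} T" using A(2) by (auto simp: T_def)
    then show "k \<in> prod_encode ` Sigma {n. D n \<inter> \<Union>\<K> \<noteq> {}} T"
      using k by (metis image_eqI prod_decode_inverse)
  qed
  ultimately show "finite {k. Law_trace X D W k \<inter> \<K> \<noteq> {}}"
    using finite_surj by blast
qed

section \<open>Continuous functions and R-open sets on the hyperspace\<close>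

lemma continuous_map_Law_Max:
  fixes f :: "'a \<Rightarrow> real"
  assumes "continuous_map X euclideanreal f"
  shows "continuous_map (Law X) euclideanreal (\<lambda>A. Max (f ` A))"
  unfolding continuous_map_upper_lower_semicontinuous_lt
proof (intro conjI allI)
  fix a
  have gt: "openin X {x \<in> topspace X. f x > a}" and lt: "openin X {x \<in> topspace X. f x < a}"
    using assms unfolding continuous_map_upper_lower_semicontinuous_lt by auto
  \<comment> \<open>A maximum above \<open>a\<close> is a meeting condition, a maximum below
    \<open>a\<close> a containment condition; both are open in the Vietoris topology.\<close>
  have "Max (f ` A) > a \<longleftrightarrow> A \<inter> {x \<in> topspace X. f x > a} \<noteq> {}" if "A \<in> topspace (Law X)" for A
    using that Max_gr_iff[of "f ` A" a] unfolding topspace_Law by blast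
  then have "{A \<in> topspace (Law X). Max (f ` A) > a} =
      {A \<in> topspace (Law X). A \<inter> {x \<in> topspace X. f x > a} \<noteq> {}}"
    by blast
  then show "openin (Law X) {A \<in> topspace (Law X). Max (f ` A) > a}"
    using openin_Law_meets[OF gt] by simp
  have "Max (f ` A) < a \<longleftrightarrow> A \<subseteq> {x \<in> topspace X. f x < a}" if "A \<in> topspace (Law X)" for A
    using that Max_less_iff[of "f ` A" a] unfolding topspace_Law by blast
  then have "{A \<in> topspace (Law X). Max (f ` A) < a} =
      {A \<in> topspace (Law X). A \<subseteq> {x \<in> topspace X. f x < a}}"
    by blast
  then show "openin (Law X) {A \<in> topspace (Law X). Max (f ` A) < a}"
    using openin_Law_subset[OF lt] by simp
qed

lemma R_open_in_Law_meets:
  assumes X: "completely_regular_space X" and \<U>: "finite \<U>" "\<And>U. U \<in> \<U> \<Longrightarrow> openin X U"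
  shows "R_open_in (Law X) {A \<in> topspace (Law X). \<forall>U\<in>\<U>. A \<inter> U \<noteq> {}}"
  unfolding R_open_in_def
proof (intro conjI ballI)
  fix A assume A: "A \<in> {A \<in> topspace (Law X). \<forall>U\<in>\<U>. A \<inter> U \<noteq> {}}"
  have "\<exists>f::'a \<Rightarrow> real. continuous_map X (top_of_set {0..1}) f \<and> 1 \<in> f ` A \<and>
      f ` (topspace X - U) \<subseteq> {0}" if "U \<in> \<U>" for U
  proof -
    obtain a where a: "a \<in> A" "a \<in> U" using A \<open>U \<in> \<U>\<close> by blast
    have "closedin X (topspace X - U)" "a \<in> topspace X - (topspace X - U)"
      using \<U>(2)[OF \<open>U \<in> \<U>\<close>] a openin_subset by auto
    then obtain f :: "'a \<Rightarrow> real" where f: "continuous_map X (top_of_set {0..1}) f" "f a = 0"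
      "f ` (topspace X - U) \<subseteq> {1}"
      using X unfolding completely_regular_space_def by blast
    have "continuous_map X (top_of_set {0..1}) (\<lambda>x. 1 - f x)"
      using f(1) by (auto simp: continuous_map_in_subtopology intro!: continuous_intros)
    then show ?thesis using f(2,3) a(1) by (intro exI[of _ "\<lambda>x. 1 - f x"]) force
  qed
  then have "\<forall>U\<in>\<U>. \<exists>f::'a \<Rightarrow> real. continuous_map X (top_of_set {0..1}) f \<and> 1 \<in> f ` A \<and>
      f ` (topspace X - U) \<subseteq> {0}" ..
  from bchoice[OF this] obtain f where f: "\<forall>U\<in>\<U>. continuous_map X (top_of_set {0..1::real}) (f U) \<and>
      1 \<in> f U ` A \<and> f U ` (topspace X - U) \<subseteq> {0}" ..
  have f01: "f U x \<in> {0..1}" if "U \<in> \<U>" "x \<in> topspace X" for U x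
  proof -
    have "f U \<in> topspace X \<rightarrow> {0..1}" using f that(1) by (simp add: continuous_map_in_subtopology)
    then show ?thesis using that(2) by (rule funcset_mem)
  qed
  \<comment> \<open>The product is 1 at \<open>A\<close>, where every factor is 1, and 0 at any
    \<open>B\<close> missing some \<open>U\<close> in \<U>, where the factor for \<open>U\<close>
    vanishes.\<close>
  define g where "g B = (\<Prod>U\<in>\<U>. Max (f U ` B))" for B
  have Max_in: "Max (f U ` B) \<in> f U ` B" if "B \<in> topspace (Law X)" for U B
    using that by (intro Max_in) (auto simp: topspace_Law)
  have Max01: "Max (f U ` B) \<in> {0..1}" if U: "U \<in> \<U>" and B: "B \<in> topspace (Law X)" for U B
  proof -
    obtain b where "b \<in> B" "Max (f U ` B) = f U b" using Max_in[OF B, of U] by blast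
    moreover from this have "b \<in> topspace X" using B by (auto simp: topspace_Law)
    ultimately show ?thesis using f01[OF U] by simp
  qed
  have "continuous_map (Law X) euclideanreal g"
    unfolding g_def using f \<U>(1)
    by (intro continuous_map_prod continuous_map_Law_Max) (auto simp: continuous_map_in_subtopology)
  moreover have "g B \<in> {0..1}" if "B \<in> topspace (Law X)" for B
    using Max01[OF _ that] unfolding g_def by (auto intro!: prod_nonneg prod_le_1)
  ultimately have "continuous_map (Law X) (top_of_set {0..1}) g"
    by (auto simp: continuous_map_in_subtopology)
  moreover have "g A = 1"
  proof -
    have AL: "A \<in> topspace (Law X)" using A by blast
    have "Max (f U ` A) = 1" if "U \<in> \<U>" for U
    proof (rule antisym)
      show "Max (f U ` A) \<le> 1" using Max01[OF that AL] by simp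
      have "finite (f U ` A)" using AL by (simp add: topspace_Law)
      then show "1 \<le> Max (f U ` A)" using f that by (intro Max_ge) auto
    qed
    then show ?thesis by (simp add: g_def)
  qed
  moreover have "g B = 0" if B: "B \<in> topspace (Law X)" "U \<in> \<U>" "B \<inter> U = {}" for B U
  proof -
    have "f U ` B \<subseteq> {0}" using f B by (fastforce simp: topspace_Law)
    then have "Max (f U ` B) = 0" using Max_in[OF B(1), of U] by blast
    then show ?thesis using \<U>(1) B(2) by (auto simp: g_def)
  qed
  ultimately show "\<exists>g::'a set \<Rightarrow> real. continuous_map (Law X) (top_of_set {0..1}) g \<and> g A = 1 \<and>
      g ` (topspace (Law X) - {A \<in> topspace (Law X). \<forall>U\<in>\<U>. A \<inter> U \<noteq> {}}) \<subseteq> {0}"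
    by (intro exI[of _ g]) auto
qed auto

section \<open>Fans\<close>

lemma in_closure_of_meets:
  assumes "x \<in> X closure_of C" "openin X T" "x \<in> T"
  obtains y where "y \<in> C" "y \<in> T"
  using assms unfolding in_closure_of by blast

text \<open>A compact family in \<^term>\<open>Law X\<close> contains \<open>{a, s n, \<dots>, s (n + i)}\<close> only for finitely many \<open>i\<close>,
  as a limit would contain infinitely many terms of \<open>s\<close>.\<close>

lemma fan_in_Law:
  fixes X :: "'a topology"
  assumes X: "t1_space X" "regular_space X" "sequential_space X" and x: "x \<in> topspace X"
    and D: "compact_finite_seq X D" "\<And>n. D n \<subseteq> topspace X"
    and E: "\<And>n. countable (E n)" "\<And>n. E n \<subseteq> D n"
    and accumulating: "\<And>U. openin X U \<Longrightarrow> x \<in> U \<Longrightarrow> infinite {n. E n \<inter> U \<noteq> {}}"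
  shows "\<exists>F. Fin_omega_fan (Law X) F \<and>
    (completely_regular_space X \<and> (\<forall>n. openin X (D n)) \<longrightarrow> strong_Fin_omega_fan (Law X) F)"
proof -
  \<comment> \<open>The compact set {x} meets only finitely many \<open>D n\<close>, so accumulation
    at \<open>x\<close> prevents it from being open; this makes a nontrivial sequence converging to
    \<open>x\<close> available.\<close>
  have "\<not> openin X {x}"
  proof
    assume "openin X {x}"
    then have "infinite {n. E n \<inter> {x} \<noteq> {}}" using accumulating by blast
    moreover have "finite {n. D n \<inter> {x} \<noteq> {}}"
      using D(1)[unfolded compact_finite_seq_def, rule_format, of "{x}"] x by simp
    moreover have "{n. E n \<inter> {x} \<noteq> {}} \<subseteq> {n. D n \<inter> {x} \<noteq> {}}" using E(2) by blast
    ultimately show False using finite_subset by blast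
  qed
  then obtain s :: "nat \<Rightarrow> 'a" where s: "inj s" "range s \<subseteq> topspace X - {x}"
    and lim: "limitin X s x sequentially"
    using sequential_space_injective_sequence[OF X(1,3) x] by auto
  obtain W :: "nat \<Rightarrow> 'a set" where W: "\<And>j. openin X (W j)" "\<And>j. s j \<in> W j"
    "\<And>i j. i \<noteq> j \<Longrightarrow> X closure_of W i \<inter> X closure_of W j = {}"
    using convergent_sequence_disjoint_neighbourhoods[OF X(1,2) s lim] by auto
  \<comment> \<open>\<open>F k\<close> has at most one member: \<open>to_nat_on\<close> numbers the
    countable set \<open>E n\<close> injectively, and \<open>F k\<close> is empty if no point has
    the number \<open>i\<close>.\<close>
  define F where "F k = (case prod_decode k of (n, i) \<Rightarrow>
    (\<lambda>a. insert a (s ` {n..n+i})) ` {a \<in> E n. to_nat_on (E n) a = i})" for k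
  have finite_F: "finite (F k)" for k
  proof -
    obtain n i where k: "prod_decode k = (n, i)" by fastforce
    have "{a \<in> E n. to_nat_on (E n) a = i} \<subseteq> {from_nat_into (E n) i}"
      using E(1)[of n] by auto
    from finite_subset[OF this] have "finite {a \<in> E n. to_nat_on (E n) a = i}" by simp
    then show ?thesis by (simp add: F_def k)
  qed
  have F_trace: "F k \<subseteq> Law_trace X D W k" for k
  proof
    fix A assume "A \<in> F k"
    moreover obtain n i where k: "prod_decode k = (n, i)" by fastforce
    ultimately obtain a where a: "a \<in> E n" "A = insert a (s ` {n..n+i})" by (auto simp: F_def)
    then have "a \<in> D n" "a \<in> topspace X" using E(2) D(2) by blast+
    moreover have "s ` {n..n+i} \<subseteq> topspace X" using s(2) by blast
    ultimately show "A \<in> Law_trace X D W k"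
      using W(2) a(2) by (auto simp: Law_trace_def k topspace_Law)
  qed
  have trace_top: "Law_trace X D W k \<subseteq> topspace (Law X)" for k
    by (auto simp: Law_trace_def split: prod.split)
  have cf: "compact_finite_seq (Law X) (Law_trace X D W)"
    using compact_finite_seq_Law_trace[OF D(1) W(1,3)] .
  have "compact_finite_seq (Law X) F"
    unfolding compact_finite_seq_def
  proof (intro allI impI)
    fix \<K> assume "compactin (Law X) \<K>"
    then have "finite {k. Law_trace X D W k \<inter> \<K> \<noteq> {}}" using cf unfolding compact_finite_seq_def by blast
    moreover have "{k. F k \<inter> \<K> \<noteq> {}} \<subseteq> {k. Law_trace X D W k \<inter> \<K> \<noteq> {}}" using F_trace by blast
    ultimately show "finite {k. F k \<inter> \<K> \<noteq> {}}" using finite_subset by blast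
  qed
  moreover have "\<not> locally_finite_seq (Law X) F"
  proof
    assume "locally_finite_seq (Law X) F"
    moreover have "{x} \<in> topspace (Law X)" using x by (simp add: topspace_Law)
    ultimately obtain V where V: "openin (Law X) V" "{x} \<in> V" "finite {k. F k \<inter> V \<noteq> {}}"
      unfolding locally_finite_seq_def by blast
    obtain U where U: "openin X U" "x \<in> U" "\<And>A. A \<in> topspace (Law X) \<Longrightarrow> A \<subseteq> U \<Longrightarrow> A \<in> V"
      using Law_singleton_neighbourhood[OF V(1,2)] by auto
    obtain N where N: "\<And>j. j \<ge> N \<Longrightarrow> s j \<in> U"
      using limitinD[OF lim U(1,2)] unfolding eventually_sequentially by auto
    \<comment> \<open>From \<open>N\<close> on, all terms of \<open>s\<close> lie in
      \<open>U\<close>, so every such \<open>n\<close> yields a set of some \<open>F k\<close>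
      inside \<open>U\<close>, with \<open>k\<close> coding a pair that starts with
      \<open>n\<close>.\<close>
    have "{n. E n \<inter> U \<noteq> {}} \<subseteq> {..<N} \<union> (\<lambda>k. fst (prod_decode k)) ` {k. F k \<inter> V \<noteq> {}}"
    proof
      fix n assume "n \<in> {n. E n \<inter> U \<noteq> {}}"
      then obtain a where a: "a \<in> E n" "a \<in> U" by blast
      show "n \<in> {..<N} \<union> (\<lambda>k. fst (prod_decode k)) ` {k. F k \<inter> V \<noteq> {}}"
      proof (cases "n < N")
        case False
        define k where "k = prod_encode (n, to_nat_on (E n) a)"
        define A where "A = insert a (s ` {n..n + to_nat_on (E n) a})"
        have "A \<in> F k" using a(1) by (auto simp: F_def k_def A_def)
        moreover have "A \<subseteq> U" using a(2) N False by (auto simp: A_def)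
        ultimately have "A \<in> F k \<inter> V" using U(3) F_trace trace_top by blast
        moreover have "fst (prod_decode k) = n" by (simp add: k_def)
        ultimately show ?thesis by blast
      qed simp
    qed
    moreover have "finite ({..<N} \<union> (\<lambda>k. fst (prod_decode k)) ` {k. F k \<inter> V \<noteq> {}})" using V(3) by simp
    ultimately show False using accumulating[OF U(1,2)] finite_subset by blast
  qed
  ultimately have fan: "Fin_omega_fan (Law X) F"
    using finite_F F_trace trace_top unfolding Fin_omega_fan_def by blast
  have "strong_Fin_omega_fan (Law X) F" if cr: "completely_regular_space X" and op: "\<forall>n. openin X (D n)"
  proof -
    \<comment> \<open>The traces that witness compact-finiteness serve as the required
      neighbourhoods once the sets \<open>D n\<close> are open.\<close>
    have "R_open_in (Law X) (Law_trace X D W k)" for k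
    proof -
      obtain n i where k: "prod_decode k = (n, i)" by fastforce
      show ?thesis
        unfolding Law_trace_def k prod.case using cr op W(1) by (intro R_open_in_Law_meets) auto
    qed
    then show ?thesis
      unfolding strong_Fin_omega_fan_def using fan F_trace cf by blast
  qed
  then show ?thesis using fan by blast
qed

text \<open>The fan construction is applied twice: first only finitely many members have x in their
  closure, then the union of the remaining members does not accumulate at x. Countable tightness
  supplies the countable sets.\<close>

lemma compact_finite_imp_locally_finite:
  fixes X :: "'a topology"
  assumes X: "t1_space X" "regular_space X" "sequential_space X"
    and no_fan: "\<not> (\<exists>F. Fin_omega_fan (Law X) F)" and \<A>: "compact_finite_in X \<A>"
  shows "locally_finite_in X \<A>"
  unfolding locally_finite_in_def
proof (intro conjI ballI)
  show top: "\<Union>\<A> \<subseteq> topspace X" using \<A> unfolding compact_finite_in_def by blast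
  have cf: "compact_finite_seq X f" if f: "inj f" "range f \<subseteq> \<A>" for f :: "nat \<Rightarrow> 'a set"
    unfolding compact_finite_seq_def
  proof (intro allI impI)
    fix K assume "compactin X K"
    then have "finite {A \<in> \<A>. A \<inter> K \<noteq> {}}" using \<A> by (simp add: compact_finite_in_def)
    moreover have "f ` {n. f n \<inter> K \<noteq> {}} \<subseteq> {A \<in> \<A>. A \<inter> K \<noteq> {}}" using f(2) by auto
    ultimately have "finite (f ` {n. f n \<inter> K \<noteq> {}})" by (rule finite_subset[rotated])
    then show "finite {n. f n \<inter> K \<noteq> {}}"
      using f(1) by (meson finite_imageD inj_on_subset subset_UNIV)
  qed
  fix x assume x: "x \<in> topspace X"
  define S where "S = {A \<in> \<A>. x \<in> X closure_of A}"
  have "finite S"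
  proof (rule ccontr)
    assume "infinite S"
    then obtain f :: "nat \<Rightarrow> 'a set" where f: "inj f" "range f \<subseteq> S"
      using infinite_countable_subset by blast
    then have f\<A>: "range f \<subseteq> \<A>" by (auto simp: S_def)
    have "\<exists>C. countable C \<and> C \<subseteq> f n \<and> x \<in> X closure_of C" for n
    proof (rule sequential_space_countable_tightness[OF X(3)])
      have "f n \<in> S" using f(2) by blast
      then show "f n \<subseteq> topspace X" "x \<in> X closure_of f n" using top by (auto simp: S_def)
    qed
    then have "\<forall>n. \<exists>C. countable C \<and> C \<subseteq> f n \<and> x \<in> X closure_of C" ..
    from choice[OF this] obtain C
      where C: "\<And>n. countable (C n)" "\<And>n. C n \<subseteq> f n" "\<And>n. x \<in> X closure_of C n" by auto
    have "C n \<inter> U \<noteq> {}" if "openin X U" "x \<in> U" for U n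
      using C(3)[of n] that by (auto simp: in_closure_of)
    then have acc: "infinite {n. C n \<inter> U \<noteq> {}}" if "openin X U" "x \<in> U" for U using that by simp
    have "f n \<subseteq> topspace X" for n using f\<A> top by blast
    from fan_in_Law[OF X x cf[OF f(1) f\<A>] this C(1,2) acc] show False using no_fan by blast
  qed
  define T where "T = \<Union>(\<A> - S)"
  have "x \<notin> X closure_of T"
  proof
    assume "x \<in> X closure_of T"
    then obtain C where C: "countable C" "C \<subseteq> T" "x \<in> X closure_of C"
      using sequential_space_countable_tightness[OF X(3), of T x] top by (auto simp: T_def)
    then have "\<forall>c\<in>C. \<exists>A. A \<in> \<A> - S \<and> c \<in> A" unfolding T_def by blast
    from bchoice[OF this] obtain A where A: "\<And>c. c \<in> C \<Longrightarrow> A c \<in> \<A> - S \<and> c \<in> A c" by auto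
    \<comment> \<open>Removing the closures of finitely many chosen members, none containing
      \<open>x\<close>, leaves a neighbourhood of \<open>x\<close>, which meets \<open>C\<close> in
      a point with a new member. This gives both infinitely many chosen members and their
      accumulation at \<open>x\<close>.\<close>
    have avoid: "\<exists>c\<in>C. c \<in> U \<and> A c \<notin> \<F>"
      if "finite \<F>" and sub: "\<F> \<subseteq> A ` C" and "openin X U" "x \<in> U" for \<F> U
    proof -
      have fin: "finite ((\<lambda>B. X closure_of B) ` \<F>)" using \<open>finite \<F>\<close> by simp
      have "\<F> \<subseteq> \<A> - S" using sub A by blast
      then have "x \<notin> \<Union>((\<lambda>B. X closure_of B) ` \<F>)" by (auto simp: S_def)
      moreover have "openin X (U - \<Union>((\<lambda>B. X closure_of B) ` \<F>))"
        using fin \<open>openin X U\<close> by (intro openin_diff closedin_Union) auto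
      ultimately obtain c where "c \<in> C" "c \<in> U - \<Union>((\<lambda>B. X closure_of B) ` \<F>)"
        using in_closure_of_meets[OF C(3)] \<open>x \<in> U\<close> by (metis DiffI)
      then have c: "c \<in> C" "c \<in> U" "c \<notin> \<Union>((\<lambda>B. X closure_of B) ` \<F>)" by blast+
      have "A c \<subseteq> X closure_of A c" using A[OF c(1)] top by (intro closure_of_subset) blast
      then have "A c \<notin> \<F>" using A[OF c(1)] c(3) by blast
      then show ?thesis using c by blast
    qed
    have "infinite (A ` C)" using avoid[of "A ` C" "topspace X"] x by blast
    define f where "f = from_nat_into (A ` C)"
    have "bij_betw f UNIV (A ` C)"
      unfolding f_def using C(1) \<open>infinite (A ` C)\<close> by (intro bij_betw_from_nat_into) auto
    then have inj: "inj f" and range: "range f = A ` C" unfolding bij_betw_def by simp_all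
    have f\<A>: "range f \<subseteq> \<A>" unfolding range using A by auto
    have acc: "infinite {n. f n \<inter> C \<inter> U \<noteq> {}}" if U: "openin X U" "x \<in> U" for U
    proof
      assume "finite {n. f n \<inter> C \<inter> U \<noteq> {}}"
      then obtain c where c: "c \<in> C" "c \<in> U" "A c \<notin> f ` {n. f n \<inter> C \<inter> U \<noteq> {}}"
        using avoid[OF _ _ U, of "f ` {n. f n \<inter> C \<inter> U \<noteq> {}}"] range by blast
      obtain n where n: "f n = A c" using range c(1) by (metis imageE imageI)
      then have "c \<in> f n \<inter> C \<inter> U" using A c by blast
      then show False using c(3) n by auto
    qed
    have f_top: "f n \<subseteq> topspace X" for n using f\<A> top by blast
    have "countable (f n \<inter> C)" for n using C(1) by blast
    from fan_in_Law[OF X x cf[OF inj f\<A>] f_top this Int_lower1 acc] show False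
      using no_fan by blast
  qed
  have "{A \<in> \<A>. A \<inter> (topspace X - X closure_of T) \<noteq> {}} \<subseteq> S"
  proof (rule subsetI, rule ccontr)
    fix A assume A: "A \<in> {A \<in> \<A>. A \<inter> (topspace X - X closure_of T) \<noteq> {}}" "A \<notin> S"
    then have "A \<subseteq> T" by (auto simp: T_def)
    also have "T \<subseteq> X closure_of T" using top by (intro closure_of_subset) (auto simp: T_def)
    finally show False using A by blast
  qed
  then have "finite {A \<in> \<A>. A \<inter> (topspace X - X closure_of T) \<noteq> {}}"
    using \<open>finite S\<close> finite_subset by blast
  then show "\<exists>V. openin X V \<and> x \<in> V \<and> finite {A \<in> \<A>. A \<inter> V \<noteq> {}}"
    using x \<open>x \<notin> X closure_of T\<close> by (intro exI[of _ "topspace X - X closure_of T"]) auto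
qed

text \<open>Closures and finite unions of levels keep local finiteness. The closures still form a
  k-network because regularity fits an open V, with closure inside U, around a compact K in
  U.\<close>

lemma locally_finite_k_network_closed_increasing:
  fixes N :: "nat \<Rightarrow> 'a set set"
  assumes X: "regular_space X" "t1_space X"
    and lf: "\<And>n. locally_finite_in X (N n)" and net: "k_network X (\<Union>n. N n)"
  obtains M :: "nat \<Rightarrow> 'a set set" where "\<And>n. locally_finite_in X (M n)"
    "\<And>n A. A \<in> M n \<Longrightarrow> closedin X A" "\<And>n. M n \<subseteq> M (Suc n)" "k_network X (\<Union>n. M n)"
proof -
  define L where "L n = (\<lambda>A. X closure_of A) ` N n" for n
  define M where "M n = (\<Union>m\<le>n. L m)" for n
  have L_lf: "locally_finite_in X (L n)" for n
    unfolding L_def using locally_finite_in_closure[OF lf] .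
  have L_top: "\<Union>(L n) \<subseteq> topspace X" for n
    using L_lf unfolding locally_finite_in_def by blast
  show thesis
  proof (rule that[of M])
    show "locally_finite_in X (M n)" for n
      unfolding locally_finite_in_def
    proof (intro conjI ballI)
      show "\<Union>(M n) \<subseteq> topspace X" using L_top by (auto simp: M_def)
      fix x assume x: "x \<in> topspace X"
      then have "\<forall>m. \<exists>V. openin X V \<and> x \<in> V \<and> finite {A \<in> L m. A \<inter> V \<noteq> {}}"
        using L_lf unfolding locally_finite_in_def by blast
      from choice[OF this] obtain V
        where V: "\<And>m. openin X (V m) \<and> x \<in> V m \<and> finite {A \<in> L m. A \<inter> V m \<noteq> {}}" by auto
      have "finite (\<Union>m\<le>n. {A \<in> L m. A \<inter> V m \<noteq> {}})" using V by blast
      moreover have "{A \<in> M n. A \<inter> (\<Inter>m\<le>n. V m) \<noteq> {}} \<subseteq> (\<Union>m\<le>n. {A \<in> L m. A \<inter> V m \<noteq> {}})"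
        by (auto simp: M_def)
      ultimately have "finite {A \<in> M n. A \<inter> (\<Inter>m\<le>n. V m) \<noteq> {}}" by (rule finite_subset[rotated])
      moreover have "openin X (\<Inter>m\<le>n. V m)" using V by (intro openin_Inter) auto
      ultimately show "\<exists>V. openin X V \<and> x \<in> V \<and> finite {A \<in> M n. A \<inter> V \<noteq> {}}"
        using V by (intro exI[of _ "\<Inter>m\<le>n. V m"]) auto
    qed
    show "closedin X A" if "A \<in> M n" for n A using that by (auto simp: M_def L_def)
    show "M n \<subseteq> M (Suc n)" for n by (fastforce simp: M_def)
    show "k_network X (\<Union>n. M n)"
      unfolding k_network_def
    proof (intro conjI allI impI)
      show "\<Union>(\<Union>n. M n) \<subseteq> topspace X" using L_top by (auto simp: M_def)
      fix U K assume UK: "openin X U \<and> compactin X K \<and> K \<subseteq> U"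
      then have "closedin X (topspace X - U)" "disjnt K (topspace X - U)" by (auto simp: disjnt_iff)
      then obtain V V' where V: "openin X V" "openin X V'" "K \<subseteq> V" "topspace X - U \<subseteq> V'" "disjnt V V'"
        using regular_space_compact_closed_separation[OF X(1)] UK by meson
      have V_top: "V \<subseteq> topspace X - V'" using V(5) openin_subset[OF V(1)] by (auto simp: disjnt_iff)
      have "closedin X (topspace X - V')" using V(2) by blast
      have closure: "X closure_of V \<subseteq> U"
        using closure_of_minimal[OF V_top \<open>closedin X (topspace X - V')\<close>] V(4) by blast
      obtain \<F> where \<F>: "finite \<F>" "\<F> \<subseteq> (\<Union>n. N n)" "K \<subseteq> \<Union>\<F>" "\<Union>\<F> \<subseteq> V"
        using net UK V unfolding k_network_def by meson
      let ?G = "(\<lambda>A. X closure_of A) ` \<F>"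
      have "\<Union>?G \<subseteq> U"
      proof -
        have "X closure_of A \<subseteq> U" if "A \<in> \<F>" for A
          using closure_of_mono[of A V X] closure \<F>(4) that by blast
        then show ?thesis by blast
      qed
      moreover have "?G \<subseteq> (\<Union>n. M n)" using \<F>(2) by (fastforce simp: M_def L_def)
      moreover have "K \<subseteq> \<Union>?G"
      proof
        fix z assume "z \<in> K"
        then obtain A where "A \<in> \<F>" "z \<in> A" using \<F>(3) by blast
        moreover have "A \<subseteq> X closure_of A"
          using \<F>(4) \<open>A \<in> \<F>\<close> openin_subset[OF V(1)] by (intro closure_of_subset) blast
        ultimately show "z \<in> \<Union>?G" by blast
      qed
      ultimately show "\<exists>\<F>. finite \<F> \<and> \<F> \<subseteq> (\<Union>n. M n) \<and> K \<subseteq> \<Union>\<F> \<and> \<Union>\<F> \<subseteq> U"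
        using \<F>(1) by (intro exI[of _ ?G]) simp
    qed
  qed
qed

text \<open>The hypothesis on fans covers two situations at once: no fans at all, and a completely
  regular space without strong fans. The fan arising here comes from open sets, so in the second
  case it is strong.\<close>

lemma metrizable_from_locally_finite_k_network:
  fixes X :: "'a topology" and N :: "nat \<Rightarrow> 'a set set"
  assumes X: "t1_space X" "regular_space X" "sequential_space X"
    and lf: "\<And>n. locally_finite_in X (N n)" and net: "k_network X (\<Union>n. N n)"
    and no_fan: "\<not> (\<exists>F. Fin_omega_fan (Law X) F \<and>
      (completely_regular_space X \<longrightarrow> strong_Fin_omega_fan (Law X) F))"
  shows "metrizable_space X"
proof -
  obtain M :: "nat \<Rightarrow> 'a set set" where M: "\<And>n. locally_finite_in X (M n)"
    "\<And>n A. A \<in> M n \<Longrightarrow> closedin X A" "\<And>n. M n \<subseteq> M (Suc n)" "k_network X (\<Union>n. M n)"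
    using locally_finite_k_network_closed_increasing[OF X(2,1) lf net] by auto
  have not_all: "\<exists>n. x \<notin> X closure_of D n"
    if x: "x \<in> topspace X" and D: "\<And>n. openin X (D n)" "compact_finite_seq X D" for x D
  proof (rule ccontr)
    assume "\<not> ?thesis"
    then have "\<exists>C. countable C \<and> C \<subseteq> D n \<and> x \<in> X closure_of C" for n
      using sequential_space_countable_tightness[OF X(3) openin_subset[OF D(1)]] by blast
    then have "\<forall>n. \<exists>C. countable C \<and> C \<subseteq> D n \<and> x \<in> X closure_of C" ..
    from choice[OF this] obtain C
      where C: "\<And>n. countable (C n)" "\<And>n. C n \<subseteq> D n" "\<And>n. x \<in> X closure_of C n" by auto
    have "C n \<inter> U \<noteq> {}" if "openin X U" "x \<in> U" for U n
      using C(3)[of n] that by (auto simp: in_closure_of)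
    then have acc: "infinite {n. C n \<inter> U \<noteq> {}}" if "openin X U" "x \<in> U" for U using that by simp
    from fan_in_Law[OF X x D(2) openin_subset[OF D(1)] C(1,2) acc] show False
      using no_fan D(1) by blast
  qed
  have M_mono: "M m \<subseteq> M n" if "m \<le> n" for m n
    using lift_Suc_mono_le[of M m n] M(3) that by blast
  have star: "\<exists>n. x \<in> X interior_of \<Union>{A \<in> M n. A \<subseteq> U}" if U: "openin X U" "x \<in> U" for U x
  proof (rule ccontr)
    assume not_int: "\<not> ?thesis"
    define P where "P n = \<Union>{A \<in> M n. A \<subseteq> U}" for n
    have closed_P: "closedin X (P n)" for n
      unfolding P_def
      by (rule closedin_locally_finite_Union)
        (auto simp: M(2) intro: locally_finite_in_subset[OF M(1)[of n]])
    have P_mono: "P m \<subseteq> P n" if "m \<le> n" for m n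
      using M_mono[OF that] by (auto simp: P_def)
    obtain V where V: "openin X V" "x \<in> V" "X closure_of V \<subseteq> U"
      using regular_space_shrink[OF X(2) U] by blast
    have x: "x \<in> topspace X" using U openin_subset by blast
    have VV: "V \<subseteq> X closure_of V" using closure_of_subset[OF openin_subset[OF V(1)]] .
    have "openin X (V - P n)" for n using V(1) closed_P by blast
    \<comment> \<open>The k-network covers the part of \<open>K\<close> in the closure of
      \<open>V\<close> by finitely many members inside \<open>U\<close>, all in one level
      \<open>m\<close>; hence \<open>P n\<close> contains \<open>V \<inter> K\<close> for
      \<open>n \<ge> m\<close>.\<close>
    moreover have "compact_finite_seq X (\<lambda>n. V - P n)"
      unfolding compact_finite_seq_def
    proof (intro allI impI)
      fix K assume "compactin X K"
      then have "compactin X (X closure_of V \<inter> K)"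
        using closed_Int_compactin closedin_closure_of by blast
      then obtain \<F> where \<F>: "finite \<F>" "\<F> \<subseteq> (\<Union>n. M n)" "X closure_of V \<inter> K \<subseteq> \<Union>\<F>" "\<Union>\<F> \<subseteq> U"
        using M(4) U(1) V(3) unfolding k_network_def by (meson le_infI1)
      then have "\<forall>A\<in>\<F>. \<exists>n. A \<in> M n" by blast
      from bchoice[OF this] obtain r where r: "\<And>A. A \<in> \<F> \<Longrightarrow> A \<in> M (r A)" by auto
      define m where "m = Max (insert 0 (r ` \<F>))"
      have "A \<in> M m" if "A \<in> \<F>" for A
        using M_mono[of "r A" m] r[OF that] that \<F>(1) by (auto simp: m_def)
      then have "V \<inter> K \<subseteq> P m" using \<F>(3,4) VV unfolding P_def by blast
      then have "{n. (V - P n) \<inter> K \<noteq> {}} \<subseteq> {..<m}" using P_mono[of m] by (fastforce simp: not_less)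
      then show "finite {n. (V - P n) \<inter> K \<noteq> {}}" using finite_subset by blast
    qed
    ultimately obtain n where "x \<notin> X closure_of (V - P n)" using not_all[OF x, of "\<lambda>n. V - P n"] by auto
    then obtain T where T: "openin X T" "x \<in> T" "T \<inter> (V - P n) = {}"
      using x unfolding in_closure_of by blast
    have "openin X (T \<inter> V)" "x \<in> T \<inter> V" "T \<inter> V \<subseteq> P n" using T V by blast+
    then have "x \<in> X interior_of P n" unfolding interior_of_def by blast
    then show False using not_int by (simp add: P_def)
  qed
  interpret star_network X M
    using M star by unfold_locales auto
  show ?thesis using metrizable_space X(1) .
qed

section \<open>The equivalences\<close>

text \<open>Points of compact sets are \<open>G\<^sub>\<delta>\<close> there, because a compact set meets only countably many members of
  the network; hence compact sets are first countable.\<close>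

lemma k_star_metrizable_k_space_imp_sequential:
  assumes X: "k_star_metrizable_space X" and k: "k_space X"
  shows "sequential_space X"
  unfolding sequential_space_def
proof (intro allI impI)
  fix A assume A: "A \<subseteq> topspace X \<and> \<not> closedin X A"
  have reg: "t1_space X" "regular_space X"
    using X unfolding k_star_metrizable_space_def by blast+
  then have haus: "Hausdorff_space X" by (simp add: regular_t1_imp_Hausdorff_space)
  obtain N :: "nat \<Rightarrow> 'a set set" where N: "\<And>n. compact_finite_in X (N n)" "k_network X (\<Union>n. N n)"
    using X unfolding k_star_metrizable_space_def by blast
  obtain K where K: "compactin X K" "\<not> closedin (subtopology X K) (K \<inter> A)"
    using k A unfolding k_space_def by blast
  have K_closed: "closedin X K" using compactin_imp_closedin[OF haus K(1)] .
  have "\<not> closedin X (K \<inter> A)" using K(2) by (metis closedin_subtopology inf.absorb1 inf_le1)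
  then have "\<not> X closure_of (K \<inter> A) \<subseteq> K \<inter> A"
    using A by (metis closure_of_subset_eq closure_of_subset inf.coboundedI2)
  then obtain y where y: "y \<in> X closure_of (K \<inter> A)" "y \<notin> K \<inter> A" by blast
  have "X closure_of (K \<inter> A) \<subseteq> K" using closure_of_minimal[OF _ K_closed] by blast
  then have yK: "y \<in> K" "y \<notin> A" using y by blast+
  have yX: "y \<in> topspace X" using yK closedin_subset[OF K_closed] by blast
  \<comment> \<open>The empty set makes \<open>G\<close> nonempty, so that
    \<open>from_nat_into\<close> enumerates exactly \<open>G\<close>; its closure avoids
    \<open>y\<close> anyway.\<close>
  define G where "G = insert {} {B \<in> (\<Union>n. N n). B \<inter> K \<noteq> {} \<and> y \<notin> X closure_of B}"
  have "countable (\<Union>n. {B \<in> N n. B \<inter> K \<noteq> {}})"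
    using N(1) K(1)
    by (intro countable_UN[OF countableI_type] countable_finite) (simp add: compact_finite_in_def)
  then have "countable {B \<in> (\<Union>n. N n). B \<inter> K \<noteq> {} \<and> y \<notin> X closure_of B}"
    by (rule countable_subset[rotated]) auto
  then have "countable G" unfolding G_def by (rule countable_insert)
  define g where "g = from_nat_into G"
  have g: "range g = G"
    unfolding g_def using \<open>countable G\<close> by (intro range_from_nat_into) (simp_all add: G_def)
  have "\<exists>V. openin X V \<and> y \<in> V \<and> X closure_of V \<subseteq> topspace X - X closure_of g j" for j
  proof (rule regular_space_shrink[OF reg(2)])
    have "g j \<in> G" unfolding g[symmetric] by simp
    then have "g j = {} \<or> y \<notin> X closure_of g j" unfolding G_def by blast
    then have "y \<notin> X closure_of g j" by (elim disjE) simp_all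
    then show "y \<in> topspace X - X closure_of g j" using yX by simp
  qed (intro openin_diff openin_topspace closedin_closure_of)
  then have "\<forall>j. \<exists>V. openin X V \<and> y \<in> V \<and> X closure_of V \<subseteq> topspace X - X closure_of g j" ..
  from choice[OF this] obtain H where H: "\<And>j. openin X (H j)" "\<And>j. y \<in> H j"
    "\<And>j. X closure_of H j \<subseteq> topspace X - X closure_of g j" by auto
  \<comment> \<open>By regularity some network member contains \<open>z\<close> while its closure
    misses \<open>y\<close>, so it is one of the \<open>g j\<close>. Within \<open>K\<close> the
    closures of the \<open>H j\<close> thus have only \<open>y\<close> in common.\<close>
  have separated: "\<exists>j. z \<notin> X closure_of H j" if z: "z \<in> K" "z \<noteq> y" for z
  proof -
    have zX: "z \<in> topspace X" using z closedin_subset[OF K_closed] by blast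
    have "openin X (topspace X - {y})" using reg(1) yX by (auto simp: t1_space_closedin_singleton)
    then obtain U where U: "openin X U" "z \<in> U" "X closure_of U \<subseteq> topspace X - {y}"
      using regular_space_shrink[OF reg(2), of "topspace X - {y}" z] z zX by blast
    have "openin X U \<and> compactin X {z} \<and> {z} \<subseteq> U" using U zX by simp
    then obtain \<F> where \<F>: "finite \<F>" "\<F> \<subseteq> (\<Union>n. N n)" "{z} \<subseteq> \<Union>\<F>" "\<Union>\<F> \<subseteq> U"
      using N(2) unfolding k_network_def by meson
    then obtain B where B: "B \<in> \<F>" "z \<in> B" by blast
    then have BU: "B \<subseteq> U" using \<F>(4) by blast
    then have "y \<notin> X closure_of B" using closure_of_mono[OF BU, of X] U(3) by blast
    then have "B \<in> G" using B z \<F>(2) by (auto simp: G_def)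
    then obtain j where "B = g j" unfolding g[symmetric] by (rule rangeE)
    then have "z \<in> X closure_of g j"
      using closure_of_subset[of B X] B BU openin_subset[OF U(1)] by blast
    then show ?thesis using H(3)[of j] by blast
  qed
  have "\<exists>a. a \<in> K \<inter> A \<and> a \<in> (\<Inter>j\<le>n. H j)" for n
  proof -
    have "openin X (\<Inter>j\<le>n. H j)" "y \<in> (\<Inter>j\<le>n. H j)" using H by (auto intro!: openin_Inter)
    then show ?thesis using in_closure_of_meets[OF y(1)] by metis
  qed
  then have "\<forall>n. \<exists>a. a \<in> K \<inter> A \<and> a \<in> (\<Inter>j\<le>n. H j)" ..
  from choice[OF this] obtain a where a: "\<And>n. a n \<in> K \<inter> A" "\<And>n j. j \<le> n \<Longrightarrow> a n \<in> H j" by auto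
  have "limitin X a y sequentially"
    unfolding limitin_def
  proof (intro conjI allI impI)
    fix U assume U: "openin X U \<and> y \<in> U"
    \<comment> \<open>These sets cover the compact part of \<open>K\<close> outside
      \<open>U\<close>. A finite subcover bounds the indices \<open>j\<close> involved, and
      \<open>a n\<close> lies in \<open>H j\<close> as soon as \<open>j \<le> n\<close>.\<close>
    define co where "co j = topspace X - X closure_of H j" for j
    have "compactin X (K \<inter> (topspace X - U))"
      using K(1) U by (intro compact_Int_closedin) auto
    moreover have "openin X W" if "W \<in> range co" for W using that by (auto simp: co_def)
    moreover have "K \<inter> (topspace X - U) \<subseteq> \<Union>(range co)"
      using separated U by (fastforce simp: co_def)
    ultimately have "\<exists>\<F>. finite \<F> \<and> \<F> \<subseteq> range co \<and> K \<inter> (topspace X - U) \<subseteq> \<Union>\<F>" by (rule compactinD)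
    then obtain \<F> where \<F>: "finite \<F>" "\<F> \<subseteq> range co" "K \<inter> (topspace X - U) \<subseteq> \<Union>\<F>" by auto
    obtain J where J: "finite J" "\<F> = co ` J"
      using finite_subset_image[OF \<F>(1,2)] by auto
    have "a n \<in> U" if n: "n \<ge> Max (insert 0 J)" for n
    proof (rule ccontr)
      assume "a n \<notin> U"
      moreover have "a n \<in> K" "a n \<in> topspace X" using a(1)[of n] A by auto
      ultimately obtain j where j: "j \<in> J" "a n \<in> co j" using \<F>(3) J(2) by blast
      have "j \<le> n" using n j(1) J(1) by auto
      then have "a n \<in> H j" by (rule a(2))
      then show False
        using j(2) closure_of_subset[OF openin_subset[OF H(1)[of j]]] unfolding co_def by blast
    qed
    then show "\<forall>\<^sub>F n in sequentially. a n \<in> U" unfolding eventually_sequentially by blast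
  qed (fact yX)
  then show "\<exists>s l. range s \<subseteq> A \<and> l \<in> topspace X - A \<and> limitin X s l sequentially"
    using a(1) yX yK(2) by (intro exI[of _ a] exI[of _ y]) auto
qed

text \<open>The union of those \<open>F n\<close> that miss a point y meets each compact set in a
  finite set, so it is closed. Its complement is a neighbourhood of y meeting only sets
  \<open>F n\<close> that contain y, and these are finitely many since {y} is compact.\<close>

lemma k_space_no_Fin_omega_fan:
  assumes t1: "t1_space Y" and k: "k_space Y"
  shows "\<not> Fin_omega_fan Y F"
proof
  assume F: "Fin_omega_fan Y F"
  then have finF: "\<And>n. finite (F n)" "\<And>n. F n \<subseteq> topspace Y"
    and cf: "\<And>K. compactin Y K \<Longrightarrow> finite {n. F n \<inter> K \<noteq> {}}"
    unfolding Fin_omega_fan_def compact_finite_seq_def by blast+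
  have "locally_finite_seq Y F"
    unfolding locally_finite_seq_def
  proof
    fix y assume y: "y \<in> topspace Y"
    define T where "T = (\<Union>n\<in>{n. y \<notin> F n}. F n)"
    have T_top: "T \<subseteq> topspace Y" using finF(2) by (auto simp: T_def)
    have "closedin (subtopology Y K) (K \<inter> T)" if K: "compactin Y K" for K
    proof -
      have "K \<inter> T \<subseteq> (\<Union>n\<in>{n. F n \<inter> K \<noteq> {}}. F n)" by (auto simp: T_def)
      moreover have "finite (\<Union>n\<in>{n. F n \<inter> K \<noteq> {}}. F n)" using cf[OF K] finF(1) by blast
      ultimately have "finite (K \<inter> T)" by (rule finite_subset)
      then have "closedin Y (K \<inter> T)" using t1 T_top by (simp add: t1_space_closedin_finite le_infI2)
      then show ?thesis by (intro closedin_subset_topspace) auto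
    qed
    then have "closedin Y T" using k T_top unfolding k_space_def by blast
    then have "openin Y (topspace Y - T)" by blast
    moreover have "y \<in> topspace Y - T" using y by (auto simp: T_def)
    moreover have "finite {n. F n \<inter> (topspace Y - T) \<noteq> {}}"
    proof (rule finite_subset)
      show "{n. F n \<inter> (topspace Y - T) \<noteq> {}} \<subseteq> {n. F n \<inter> {y} \<noteq> {}}" by (auto simp: T_def)
      show "finite {n. F n \<inter> {y} \<noteq> {}}" using cf[of "{y}"] y by simp
    qed
    ultimately show "\<exists>V. openin Y V \<and> y \<in> V \<and> finite {n. F n \<inter> V \<noteq> {}}" by blast
  qed
  then show False using F by (simp add: Fin_omega_fan_def)
qed

section \<open>Necessary properties of metrizable spaces\<close>

lemma locally_finite_imp_compact_finite:
  assumes "locally_finite_in X \<A>"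
  shows "compact_finite_in X \<A>"
  unfolding compact_finite_in_def
proof (intro conjI allI impI)
  show "\<Union>\<A> \<subseteq> topspace X" using assms unfolding locally_finite_in_def by blast
  fix K assume K: "compactin X K"
  define \<V> where "\<V> = {V. openin X V \<and> finite {A \<in> \<A>. A \<inter> V \<noteq> {}}}"
  have "K \<subseteq> \<Union>\<V>"
  proof
    fix x assume "x \<in> K"
    then have "x \<in> topspace X" using compactin_subset_topspace[OF K] by blast
    then have "\<exists>V. openin X V \<and> x \<in> V \<and> finite {A \<in> \<A>. A \<inter> V \<noteq> {}}"
      using assms by (simp add: locally_finite_in_def)
    then show "x \<in> \<Union>\<V>" by (auto simp: \<V>_def)
  qed
  moreover have "openin X V" if "V \<in> \<V>" for V using that by (simp add: \<V>_def)
  ultimately obtain \<F> where \<F>: "finite \<F>" "\<F> \<subseteq> \<V>" "K \<subseteq> \<Union>\<F>"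
    using compactinD[OF K, of \<V>] by auto
  have "{A \<in> \<A>. A \<inter> K \<noteq> {}} \<subseteq> (\<Union>V\<in>\<F>. {A \<in> \<A>. A \<inter> V \<noteq> {}})" using \<F>(3) by blast
  moreover have "finite (\<Union>V\<in>\<F>. {A \<in> \<A>. A \<inter> V \<noteq> {}})" using \<F>(1,2) by (auto simp: \<V>_def)
  ultimately show "finite {A \<in> \<A>. A \<inter> K \<noteq> {}}" by (rule finite_subset)
qed

lemma aleph_space_imp_k_star_metrizable_space:
  "aleph_space X \<Longrightarrow> k_star_metrizable_space X"
  unfolding aleph_space_def k_star_metrizable_space_def
  using locally_finite_imp_compact_finite by blast

text \<open>Every base is a k-network, as a compact subset of an open U is covered by finitely many
  base members inside U; Stone's base is moreover \<sigma>-locally finite.\<close>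

lemma metrizable_imp_aleph_space:
  assumes "metrizable_space X"
  shows "aleph_space X"
proof -
  obtain B :: "nat \<Rightarrow> 'a set set" where B: "\<And>n. locally_finite_in X (B n)"
    "\<And>n U. U \<in> B n \<Longrightarrow> openin X U"
    "\<And>U x. openin X U \<Longrightarrow> x \<in> U \<Longrightarrow> \<exists>n. \<exists>V\<in>B n. x \<in> V \<and> V \<subseteq> U"
    using metrizable_imp_sigma_locally_finite_base[OF assms] by auto
  have "k_network X (\<Union>n. B n)"
    unfolding k_network_def
  proof (intro conjI allI impI)
    show "\<Union>(\<Union>n. B n) \<subseteq> topspace X" using B(2) openin_subset by blast
    fix U K assume UK: "openin X U \<and> compactin X K \<and> K \<subseteq> U"
    define \<V> where "\<V> = {V \<in> (\<Union>n. B n). V \<subseteq> U}"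
    have "K \<subseteq> \<Union>\<V>" using B(3)[of U] UK by (fastforce simp: \<V>_def)
    moreover have "openin X V" if "V \<in> \<V>" for V using that B(2) by (auto simp: \<V>_def)
    ultimately obtain \<F> where \<F>: "finite \<F>" "\<F> \<subseteq> \<V>" "K \<subseteq> \<Union>\<F>"
      using compactinD[of X K \<V>] UK by auto
    then show "\<exists>\<F>. finite \<F> \<and> \<F> \<subseteq> (\<Union>n. B n) \<and> K \<subseteq> \<Union>\<F> \<and> \<Union>\<F> \<subseteq> U"
      by (intro exI[of _ \<F>]) (auto simp: \<V>_def)
  qed
  then show ?thesis
    unfolding aleph_space_def
    using B(1) metrizable_imp_t1_space[OF assms] metrizable_imp_regular_space[OF assms] by auto
qed

lemma metrizable_imp_sequential_space:
  assumes "metrizable_space X"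
  shows "sequential_space X"
proof -
  obtain M d where "Metric_space M d" and X: "X = Metric_space.mtopology M d"
    using assms unfolding metrizable_space_def by blast
  interpret Metric_space M d by fact
  show ?thesis
    unfolding sequential_space_def X
  proof (intro allI impI)
    fix A assume A: "A \<subseteq> topspace mtopology \<and> \<not> closedin mtopology A"
    then obtain s l where sl: "range s \<subseteq> A" "limitin mtopology s l sequentially" "l \<notin> A"
      unfolding metric_closedin_iff_sequentially_closed by auto
    then show "\<exists>s l. range s \<subseteq> A \<and> l \<in> topspace mtopology - A \<and> limitin mtopology s l sequentially"
      using limitin_topspace[OF sl(2)] by (intro exI[of _ s] exI[of _ l]) simp
  qed
qed

section \<open>Sufficient conditions for metrizability\<close>

lemma k_star_metrizable_no_fan_imp_metrizable:
  assumes X: "k_star_metrizable_space X" and k: "k_space X"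
    and no_fan: "\<not> (\<exists>F. Fin_omega_fan (Law X) F)"
  shows "metrizable_space X"
proof -
  have reg: "t1_space X" "regular_space X"
    using X unfolding k_star_metrizable_space_def by blast+
  obtain N :: "nat \<Rightarrow> 'a set set" where N: "\<And>n. compact_finite_in X (N n)" "k_network X (\<Union>n. N n)"
    using X unfolding k_star_metrizable_space_def by blast
  have seq: "sequential_space X" using k_star_metrizable_k_space_imp_sequential[OF X k] .
  have "locally_finite_in X (N n)" for n
    using compact_finite_imp_locally_finite[OF reg seq no_fan N(1)] .
  then show ?thesis
    using metrizable_from_locally_finite_k_network[OF reg seq _ N(2)] no_fan by blast
qed

lemma aleph_no_strong_fan_imp_metrizable:
  assumes "Tychonoff_space X" "sequential_space X" "aleph_space X"
    and no_fan: "\<not> (\<exists>F. strong_Fin_omega_fan (Law X) F)"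
  shows "metrizable_space X"
proof -
  have "t1_space X" "regular_space X" "completely_regular_space X"
    using assms(1,3) unfolding aleph_space_def Tychonoff_space_def by blast+
  moreover obtain N :: "nat \<Rightarrow> 'a set set"
    where "\<And>n. locally_finite_in X (N n)" "k_network X (\<Union>n. N n)"
    using assms(3) unfolding aleph_space_def by blast
  ultimately show ?thesis
    using metrizable_from_locally_finite_k_network[of X N] assms(2) no_fan by blast
qed

lemma functionally_Hausdorff_imp_Hausdorff_space:
  assumes "functionally_Hausdorff_space X"
  shows "Hausdorff_space X"
  unfolding Hausdorff_space_def
proof (intro allI impI)
  fix x y assume "x \<in> topspace X \<and> y \<in> topspace X \<and> x \<noteq> y"
  then obtain f :: "'a \<Rightarrow> real" where f: "continuous_map X (top_of_set {0..1}) f" "f x = 0" "f y = 1"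
    and xy: "x \<in> topspace X" "y \<in> topspace X"
    using assms unfolding functionally_Hausdorff_space_def by blast
  have cont: "continuous_map X euclideanreal f"
    using f(1) by (simp add: continuous_map_in_subtopology)
  have "openin X {z \<in> topspace X. f z \<in> {..<1/2}}" "openin X {z \<in> topspace X. f z \<in> {1/2<..}}"
    by (rule openin_continuous_map_preimage[OF cont], simp)+
  then show "\<exists>U V. openin X U \<and> openin X V \<and> x \<in> U \<and> y \<in> V \<and> disjnt U V"
    using f xy by (intro exI[of _ "{z \<in> topspace X. f z \<in> {..<1/2}}"]
        exI[of _ "{z \<in> topspace X. f z \<in> {1/2<..}}"]) (auto simp: disjnt_iff)
qed

theorem theorem1p21:
  fixes X :: "'a topology"
  assumes "functionally_Hausdorff_space X"
  shows "(metrizable_space X \<longleftrightarrow> metrizable_space (Law X)) \<and>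
    (metrizable_space X \<longleftrightarrow>
       k_star_metrizable_space X \<and> k_space X \<and> \<not> (\<exists>F. Fin_omega_fan (Law X) F)) \<and>
    (metrizable_space X \<longleftrightarrow>
       Tychonoff_space X \<and> sequential_space X \<and> aleph_space X \<and>
       \<not> (\<exists>F. strong_Fin_omega_fan (Law X) F)) \<and>
    (metrizable_space X \<longleftrightarrow> k_star_metrizable_space X \<and> k_space (Law X))"
proof -
  have haus: "Hausdorff_space X"
    using assms by (rule functionally_Hausdorff_imp_Hausdorff_space)
  have no_fan: "\<not> (\<exists>F. Fin_omega_fan (Law X) F)" if "k_space (Law X)"
    using k_space_no_Fin_omega_fan[OF t1_space_Law that] Hausdorff_imp_t1_space[OF haus] by blast
  have strong: "\<not> (\<exists>F. strong_Fin_omega_fan (Law X) F)" if "\<not> (\<exists>F. Fin_omega_fan (Law X) F)"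
    using that unfolding strong_Fin_omega_fan_def by blast
  have necessary: "k_star_metrizable_space X \<and> k_space X \<and> Tychonoff_space X \<and>
      sequential_space X \<and> aleph_space X \<and> k_space (Law X)" if "metrizable_space X"
    using that metrizable_imp_aleph_space aleph_space_imp_k_star_metrizable_space
      metrizable_imp_k_space metrizable_imp_sequential_space metrizable_imp_t1_space
      metrizable_imp_completely_regular_space metrizable_space_Law
    unfolding Tychonoff_space_def by metis
  \<comment> \<open>The k-property descends from the hyperspace to the closed copy of
    \<open>X\<close> and excludes fans in the hyperspace, which reduces this case to the fan-free
    one.\<close>
  have "metrizable_space X" if "k_star_metrizable_space X" "k_space (Law X)"
    using k_star_metrizable_no_fan_imp_metrizable[OF that(1) k_space_Law_imp_k_space[OF haus that(2)]]
      no_fan[OF that(2)] by blast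
  then show ?thesis
    using metrizable_space_Law_iff[of X] k_star_metrizable_no_fan_imp_metrizable[of X]
      aleph_no_strong_fan_imp_metrizable[of X] necessary no_fan strong by metis
qed

end
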